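(* Let $n\geq 3$ be an integer and let $\xi$ be a transcendental real number. If $n\geq 4$, then $\widehat{\omega}_n(\xi)\leq 2n-2$. For $n=3$, one has $\widehat{\omega}_3(\xi)\leq 2+\sqrt 5$.
   Context: For a polynomial $P\in\mathbb{R}[X]$, $H(P)$ denotes its naive height, the largest absolute value of its coefficients; $\mathbb{Z}[X]_{\leq n}$ denotes the integer polynomials of degree at most $n$. For a real number $\xi$ and integer $n\geq1$, the uniform exponent $\widehat{\omega}_n(\xi)$ is the supremum of the real numbers $\omega>0$ such that for every sufficiently large $H$ the system $H(P)\leq H$, $0<|P(\xi)|\leq H^{-\omega}$ has a solution $P\in\mathbb{Z}[X]_{\leq n}$. *)

theory Defs
  imports "HOL-Analysis.Analysis" "HOL-Computational_Algebra.Computational_Algebra"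
begin

definition naive_height :: "real poly \<Rightarrow> real" where
  "naive_height P = Max ((\<lambda>i. \<bar>coeff P i\<bar>) ` {..degree P})"

text \<open>
  Integer polynomials are represented, as in the library's \<^const>\<open>algebraic\<close>, by real polynomials
  all of whose coefficients lie in \<^term>\<open>\<int> :: real set\<close>. The zero polynomial is included.
\<close>
definition int_polys_upto :: "nat \<Rightarrow> real poly set" where
  "int_polys_upto n = {P. (\<forall>i. coeff P i \<in> \<int>) \<and> degree P \<le> n}"

text \<open>
  The parameter \<open>H\<close> ranges over the reals. The supremum is taken in \<^typ>\<open>ereal\<close> because the set of
  admissible exponents is not known in advance to be bounded: an upper bound on the supremum therefore
  includes the claim that it is finite, whereas \<^const>\<open>Sup\<close> on \<^typ>\<open>real\<close> is unspecified on
  unbounded sets.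
\<close>
definition uniform_exponent :: "nat \<Rightarrow> real \<Rightarrow> ereal" where
  "uniform_exponent n \<xi> =
     Sup (ereal ` {\<omega>. \<omega> > 0 \<and>
       (\<forall>\<^sub>F H :: real in at_top.
          \<exists>P \<in> int_polys_upto n.
            naive_height P \<le> H \<and> 0 < \<bar>poly P \<xi>\<bar> \<and> \<bar>poly P \<xi>\<bar> \<le> H powr (- \<omega>))})"

end

theory Submission
  imports Defs "Jordan_Normal_Form.Char_Poly"
begin

hide_const (open) Module.smult

text \<open>
  Let \<open>P\<^sub>i\<close> be the minimal polynomials of \<open>\<xi>\<close>, with heights \<open>H\<^sub>i\<close> and values \<open>L\<^sub>i = \<bar>P\<^sub>i(\<xi>)\<bar>\<close>, and suppose that
  \<open>L\<^sub>i \<le> C H\<^sub>i\<^sub>+\<^sub>1\<^bsup>-w\<^esup>\<close> with \<open>w > 2n - 2\<close>. Resultants show that polynomials of degree less than \<open>n\<close>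
  cannot be that small at \<open>\<xi>\<close>, so all late \<open>P\<^sub>i\<close> are irreducible of degree \<open>n\<close>. For coprime \<open>P, Q\<close> and
  \<open>R\<close> outside their span, the \<open>2n - 2\<close> polynomials \<open>X\<^sup>jP, X\<^sup>jQ\<close> with \<open>j \<le> n - 2\<close> together with
  some \<open>X\<^sup>sR\<close> are linearly independent in degree at most \<open>2n - 2\<close>, and their determinant is a nonzero
  integer. If all three heights are comparable this gives \<open>w \<le> 2n - 2\<close>.

  In general, group the \<open>P\<^sub>i\<close> into maximal runs lying in one plane. Since \<open>L\<^sub>iH\<^sub>i\<^sub>+\<^sub>1\<close> is constant along a
  run up to a bounded factor, the heights \<open>h\<^sub>0 < h\<^sub>1 < \<dots>\<close> at the ends of the runs, with ratios
  \<open>r\<^sub>j = log h\<^sub>j\<^sub>+\<^sub>1 / log h\<^sub>j\<close>, satisfy up to small errors \<open>r\<^sub>j \<le> (n - 1) / (w - n)\<close> (resultant) and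
  \<open>w \<le> (n - 2) / r\<^sub>j + n - 1 + r\<^sub>j\<^sub>+\<^sub>1\<close> (determinant). As \<open>(n - 2) / r + n - 1 + r\<close> is convex in \<open>r\<close>, for \<open>w\<close>
  beyond its values at both ends of \<open>[1, (n - 1) / (w - n)]\<close> the \<open>r\<^sub>j\<close> would increase by a fixed amount at
  each step, which is absurd. The two end points account for \<open>2n - 2\<close> and, if \<open>n = 3\<close>, for \<open>2 + \<surd>5\<close>.
\<close>

section \<open>Heights and determinants\<close>

text \<open>Copy of \<open>naive_height\<close> on \<open>int poly\<close>: the argument needs
  divisibility, primes and contents in the factorial ring of integer polynomials.\<close>

definition height :: "int poly \<Rightarrow> real" where
  "height p = Max ((\<lambda>i. \<bar>of_int (coeff p i)\<bar>) ` {..degree p})"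

definition ev :: "real \<Rightarrow> int poly \<Rightarrow> real" where
  "ev x p = poly (of_int_poly p) x"

lemma ev_add [simp]: "ev x (p + q) = ev x p + ev x q"
  and ev_mult [simp]: "ev x (p * q) = ev x p * ev x q"
  and ev_diff [simp]: "ev x (p - q) = ev x p - ev x q"
  and ev_smult [simp]: "ev x (smult c p) = of_int c * ev x p"
  and ev_monom [simp]: "ev x (monom c k) = of_int c * x ^ k"
  and ev_0 [simp]: "ev x 0 = 0"
  and ev_1 [simp]: "ev x 1 = 1"
  and ev_const [simp]: "ev x [:c:] = of_int c"
  by (simp_all add: ev_def of_int_poly_hom.hom_add of_int_poly_hom.hom_mult of_int_poly_hom.hom_minus
        map_poly_monom poly_monom hom_distribs)

lemma ev_altdef:
  assumes "degree p < N"
  shows "ev x p = (\<Sum>j<N. of_int (coeff p j) * x ^ j)"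
proof -
  have "ev x p = (\<Sum>j\<le>degree p. of_int (coeff p j) * x ^ j)"
    by (simp add: ev_def poly_altdef)
  also have "\<dots> = (\<Sum>j<N. of_int (coeff p j) * x ^ j)"
    by (rule sum.mono_neutral_left) (use assms in \<open>auto simp: coeff_eq_0\<close>)
  finally show ?thesis .
qed

lemma height_coeff: "\<bar>of_int (coeff p i)\<bar> \<le> height p"
proof (cases "i \<le> degree p")
  case True
  then show ?thesis unfolding height_def by (intro Max_ge) auto
next
  case False
  have "\<bar>of_int (coeff p 0)\<bar> \<le> height p" unfolding height_def by (intro Max_ge) auto
  moreover have "0 \<le> \<bar>real_of_int (coeff p 0)\<bar>" by simp
  ultimately show ?thesis using False by (simp add: coeff_eq_0)
qed

lemma height_le:
  assumes "\<And>i. \<bar>of_int (coeff p i)\<bar> \<le> B"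
  shows "height p \<le> B"
  unfolding height_def using assms by (intro Max.boundedI) auto

lemma height_attained: "\<exists>i. height p = of_int \<bar>coeff p i\<bar>"
proof -
  have "height p \<in> (\<lambda>i. \<bar>of_int (coeff p i)\<bar>) ` {..degree p}"
    unfolding height_def by (intro Max_in) auto
  then show ?thesis by auto
qed

lemma height_nonneg: "0 \<le> height p"
  using height_coeff[of p 0] by linarith

lemma height_ge_1:
  assumes "p \<noteq> 0"
  shows "1 \<le> height p"
proof -
  have "\<bar>coeff p (degree p)\<bar> \<ge> 1" using assms by (simp add: int_one_le_iff_zero_less)
  then have "1 \<le> \<bar>real_of_int (coeff p (degree p))\<bar>" by linarith
  with height_coeff[of p "degree p"] show ?thesis by linarith
qed

lemma height_smult: "height (smult c p) = \<bar>of_int c\<bar> * height p"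
proof (rule antisym)
  show "height (smult c p) \<le> \<bar>of_int c\<bar> * height p"
    by (rule height_le) (simp add: abs_mult mult_left_mono height_coeff)
  obtain i where i: "height p = of_int \<bar>coeff p i\<bar>" using height_attained by blast
  show "\<bar>of_int c\<bar> * height p \<le> height (smult c p)"
    using height_coeff[of "smult c p" i] by (simp add: i abs_mult)
qed

lemma height_monom_mult: "height (monom 1 k * p) = height p"
proof (rule antisym)
  have c: "coeff (monom 1 k * p) i = (if k \<le> i then coeff p (i - k) else 0)" for i
    using coeff_monom_mult[of 1 k p i] by simp
  show "height (monom 1 k * p) \<le> height p"
    by (rule height_le) (simp add: c height_coeff height_nonneg)
  show "height p \<le> height (monom 1 k * p)"
  proof (rule height_le)
    fix i show "\<bar>of_int (coeff p i)\<bar> \<le> height (monom 1 k * p)"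
      using height_coeff[of "monom 1 k * p" "i + k"] by (simp add: c)
  qed
qed

lemma finite_int_polys_bounded: "finite {p :: int poly. degree p \<le> n \<and> height p \<le> B}"
proof -
  let ?F = "{f :: nat \<Rightarrow> int. \<forall>i. (i \<in> {..n} \<longrightarrow> f i \<in> {- \<lceil>B\<rceil>..\<lceil>B\<rceil>}) \<and> (i \<notin> {..n} \<longrightarrow> f i = 0)}"
  have "finite ?F"
    by (intro finite_set_of_finite_funs) auto
  moreover have "coeff ` {p :: int poly. degree p \<le> n \<and> height p \<le> B} \<subseteq> ?F"
  proof (clarify, intro conjI impI)
    fix p :: "int poly" and i assume p: "degree p \<le> n" "height p \<le> B"
    show "coeff p i = 0" if "i \<notin> {..n}" using that p by (simp add: coeff_eq_0)
    have "\<bar>of_int (coeff p i)\<bar> \<le> B" using height_coeff[of p i] p by linarith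
    then have "\<bar>coeff p i\<bar> \<le> \<lceil>B\<rceil>" by linarith
    then show "coeff p i \<in> {- \<lceil>B\<rceil>..\<lceil>B\<rceil>}" by auto
  qed
  ultimately have "finite (coeff ` {p :: int poly. degree p \<le> n \<and> height p \<le> B})"
    by (rule finite_subset[rotated])
  then show ?thesis
    by (rule finite_imageD) (simp add: inj_on_def poly_eq_iff)
qed

section \<open>Determinants of integer polynomials\<close>

lemma abs_det_le:
  fixes M :: "real mat"
  assumes M: "M \<in> carrier_mat m m" and r: "\<And>i j. i < m \<Longrightarrow> j < m \<Longrightarrow> \<bar>M $$ (i,j)\<bar> \<le> r i"
  shows "\<bar>det M\<bar> \<le> fact m * (\<Prod>i<m. r i)"
proof -
  have "\<bar>det M\<bar> = \<bar>\<Sum>p | p permutes {0..<m}. signof p * (\<Prod>i=0..<m. M $$ (i, p i))\<bar>"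
    by (simp add: det_def'[OF M])
  also have "\<dots> \<le> (\<Sum>p | p permutes {0..<m}. \<bar>signof p * (\<Prod>i=0..<m. M $$ (i, p i))\<bar>)"
    by (rule sum_abs)
  also have "\<dots> \<le> (\<Sum>p | p permutes {0..<m}. (\<Prod>i<m. r i))"
  proof (rule sum_mono)
    fix p assume p: "p \<in> {p. p permutes {0..<m}}"
    have "\<bar>signof p * (\<Prod>i=0..<m. M $$ (i, p i))\<bar> = (\<Prod>i=0..<m. \<bar>M $$ (i, p i)\<bar>)"
      by (simp add: abs_mult abs_prod sign_def)
    also have "\<dots> \<le> (\<Prod>i=0..<m. r i)"
      using p r by (intro prod_mono) (auto simp: permutes_in_image)
    finally show "\<bar>signof p * (\<Prod>i=0..<m. M $$ (i, p i))\<bar> \<le> (\<Prod>i<m. r i)"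
      by (simp add: atLeast0LessThan)
  qed
  also have "\<dots> = fact m * (\<Prod>i<m. r i)"
    by (simp add: card_permutations)
  finally show ?thesis .
qed

text \<open>\<open>insert_index i\<close> lists the rows that survive the deletion of row
  \<open>i\<close>; the product belongs to the cofactors of that row.\<close>

lemma prod_insert_index:
  fixes h :: "nat \<Rightarrow> real"
  assumes "i < N" and "h i \<noteq> 0"
  shows "(\<Prod>k<N - 1. h (insert_index i k)) = (\<Prod>k<N. h k) / h i"
proof -
  have "insert_index i ` {..<N - 1} = {..<N} - {i}"
  proof (intro equalityI subsetI)
    fix k assume k: "k \<in> {..<N} - {i}"
    show "k \<in> insert_index i ` {..<N - 1}"
    proof (cases "k < i")
      case True
      then show ?thesis using assms by (intro image_eqI[of _ _ k]) auto
    next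
      case False
      then show ?thesis using k by (intro image_eqI[of _ _ "k - 1"]) auto
    qed
  qed (use assms in \<open>auto simp: insert_index_def split: if_splits\<close>)
  then have "(\<Prod>k<N - 1. h (insert_index i k)) = (\<Prod>k\<in>{..<N} - {i}. h k)"
    using prod.reindex[OF insert_index_inj_on[of i "{..<N - 1}"], of h] by simp
  also have "\<dots> = (\<Prod>k<N. h k) / h i"
    using assms by (simp add: prod_diff1)
  finally show ?thesis .
qed

text \<open>
  The coefficient matrix \<open>A\<close> maps \<open>(x\<^sup>j)\<^sub>j\<close> to \<open>(f\<^sub>i(x))\<^sub>i\<close>, so the entry \<open>x\<^sup>0 = 1\<close> gives
  \<open>det A = (\<Sum>i. adj A\<^sub>0\<^sub>i f\<^sub>i(x))\<close>, and the left-hand side is a nonzero integer.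
\<close>
lemma one_le_independent:
  fixes f :: "nat \<Rightarrow> int poly" and h l :: "nat \<Rightarrow> real"
  assumes N: "N > 0"
    and deg: "\<And>i. i < N \<Longrightarrow> degree (f i) < N"
    and indep: "\<And>c. (\<Sum>i<N. smult (c i) (f i)) = 0 \<Longrightarrow> \<forall>i<N. c i = 0"
    and hpos: "\<And>i. i < N \<Longrightarrow> 0 < h i"
    and h: "\<And>i. i < N \<Longrightarrow> height (f i) \<le> h i"
    and l: "\<And>i. i < N \<Longrightarrow> \<bar>ev x (f i)\<bar> \<le> l i"
  shows "1 \<le> fact N * (\<Prod>k<N. h k) * (\<Sum>i<N. l i / h i)"
proof -
  define A :: "int mat" where "A = mat N N (\<lambda>(i,j). coeff (f i) j)"
  have A: "A \<in> carrier_mat N N" by (simp add: A_def)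
  have "det A \<noteq> 0"
  proof
    assume "det A = 0"
    then have "det A\<^sup>T = 0" using det_transpose[OF A] by simp
    moreover have "A\<^sup>T \<in> carrier_mat N N" using A by simp
    ultimately obtain v where v: "v \<in> carrier_vec N" "v \<noteq> 0\<^sub>v N" "A\<^sup>T *\<^sub>v v = 0\<^sub>v N"
      using det_0_iff_vec_prod_zero by blast
    have "(\<Sum>i<N. smult (v $ i) (f i)) = 0"
    proof (rule poly_eqI)
      fix j
      show "coeff (\<Sum>i<N. smult (v $ i) (f i)) j = coeff 0 j"
      proof (cases "j < N")
        case True
        have "(A\<^sup>T *\<^sub>v v) $ j = (\<Sum>i<N. coeff (f i) j * v $ i)"
          using True v(1) A by (simp add: scalar_prod_def A_def atLeast0LessThan)
        also have "(A\<^sup>T *\<^sub>v v) $ j = 0" using v(3) True by simp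
        finally have "(\<Sum>i<N. coeff (f i) j * v $ i) = 0" by simp
        then show ?thesis by (simp add: coeff_sum mult.commute)
      next
        case False
        then have "coeff (f i) j = 0" if "i < N" for i
          using deg[OF that] by (simp add: coeff_eq_0)
        then show ?thesis by (simp add: coeff_sum)
      qed
    qed
    from indep[OF this] have "v = 0\<^sub>v N" using v by (intro eq_vecI) auto
    with v show False by simp
  qed
  then have d1: "1 \<le> \<bar>real_of_int (det A)\<bar>" by linarith
  define B :: "real mat" where "B = map_mat of_int A"
  have B: "B \<in> carrier_mat N N" using A by (simp add: B_def)
  have detB: "det B = of_int (det A)" unfolding B_def by (rule of_int_hom.hom_det)
  have Bent: "B $$ (i,j) = of_int (coeff (f i) j)" if "i < N" "j < N" for i j
    using that by (simp add: B_def A_def)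
  define X :: "real vec" where "X = vec N (\<lambda>j. x ^ j)"
  have X: "X \<in> carrier_vec N" by (simp add: X_def)
  have adj: "adj_mat B \<in> carrier_mat N N" "adj_mat B * B = det B \<cdot>\<^sub>m 1\<^sub>m N"
    using adj_mat[OF B] by auto
  have BX: "B *\<^sub>v X = vec N (\<lambda>i. ev x (f i))"
    using B by (intro eq_vecI) (auto simp: scalar_prod_def X_def Bent ev_altdef[OF deg] atLeast0LessThan)
  have "det B = ((det B \<cdot>\<^sub>m 1\<^sub>m N) *\<^sub>v X) $ 0"
    using N by (simp add: X_def scalar_prod_def if_distrib if_distribR sum.If_cases cong: if_cong)
  also have "\<dots> = (adj_mat B *\<^sub>v (B *\<^sub>v X)) $ 0"
    using assoc_mult_mat_vec[OF adj(1) B X] adj(2) by simp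
  also have "\<dots> = (\<Sum>i<N. adj_mat B $$ (0,i) * ev x (f i))"
    using N adj(1) B by (simp add: BX scalar_prod_def atLeast0LessThan)
  finally have "det B = (\<Sum>i<N. adj_mat B $$ (0,i) * ev x (f i))" .
  then have "1 \<le> \<bar>\<Sum>i<N. adj_mat B $$ (0,i) * ev x (f i)\<bar>" using d1 detB by simp
  also have "\<dots> \<le> (\<Sum>i<N. \<bar>adj_mat B $$ (0,i) * ev x (f i)\<bar>)" by (rule sum_abs)
  also have "\<dots> \<le> (\<Sum>i<N. (fact N * (\<Prod>k<N. h k) / h i) * l i)"
  proof (rule sum_mono)
    fix i assume "i \<in> {..<N}"
    then have i: "i < N" by simp
    obtain m where m: "N = Suc m" using N by (cases N) auto
    have "\<bar>adj_mat B $$ (0,i)\<bar> = \<bar>det (mat_delete B i 0)\<bar>"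
      using N i B by (simp add: adj_mat_def cofactor_def abs_mult power_abs)
    also have "\<dots> \<le> fact (N - 1) * (\<Prod>k<N - 1. h (insert_index i k))"
    proof (rule abs_det_le)
      show "mat_delete B i 0 \<in> carrier_mat (N - 1) (N - 1)" using B by (rule mat_delete_carrier)
      fix a b assume ab: "a < N - 1" "b < N - 1"
      have lt: "insert_index i a < N" "insert_index 0 b < N"
        using ab by (auto simp: insert_index_def)
      have "mat_delete B i 0 $$ (a,b) = B $$ (insert_index i a, insert_index 0 b)"
        using mat_delete_index[of B m i 0 a b] B i N ab m by simp
      also have "\<dots> = of_int (coeff (f (insert_index i a)) (insert_index 0 b))"
        by (rule Bent[OF lt])
      finally show "\<bar>mat_delete B i 0 $$ (a,b)\<bar> \<le> h (insert_index i a)"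
        using height_coeff[of "f (insert_index i a)" "insert_index 0 b"] h[OF lt(1)] by linarith
    qed
    also have "\<dots> = fact (N - 1) * ((\<Prod>k<N. h k) / h i)"
      using prod_insert_index[OF i, of h] hpos[OF i] by simp
    also have "\<dots> \<le> fact N * ((\<Prod>k<N. h k) / h i)"
      using hpos i by (intro mult_right_mono fact_mono divide_nonneg_nonneg prod_nonneg) (auto intro: less_imp_le)
    finally have "\<bar>adj_mat B $$ (0,i)\<bar> \<le> fact N * (\<Prod>k<N. h k) / h i" by simp
    then show "\<bar>adj_mat B $$ (0,i) * ev x (f i)\<bar> \<le> (fact N * (\<Prod>k<N. h k) / h i) * l i"
      unfolding abs_mult using l[OF i] by (rule mult_mono') auto
  qed
  also have "\<dots> = fact N * (\<Prod>k<N. h k) * (\<Sum>i<N. l i / h i)"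
    by (simp add: sum_distrib_left mult_ac)
  finally show ?thesis .
qed

section \<open>Resultants and triples of polynomials\<close>

lemma sum_lessThan_add:
  fixes g :: "nat \<Rightarrow> 'a :: comm_monoid_add"
  shows "(\<Sum>i<a + b. g i) = (\<Sum>i<a. g i) + (\<Sum>i<b. g (a + i))"
  by (induction b) (simp_all add: add.assoc)

lemma prod_lessThan_add:
  fixes g :: "nat \<Rightarrow> 'a :: comm_monoid_mult"
  shows "(\<Prod>i<a + b. g i) = (\<Prod>i<a. g i) * (\<Prod>i<b. g (a + i))"
  by (induction b) (simp_all add: mult.assoc)

lemma coeff_sum_monom:
  "coeff (\<Sum>i<a. monom (c i) i) k = (if k < a then c k else 0)"
  by (simp add: coeff_sum)

lemma degree_sum_monom_less:
  assumes "0 < a"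
  shows "degree (\<Sum>i<a. monom (c i) i) < a"
proof -
  have "degree (\<Sum>i<a. monom (c i) i) \<le> a - 1"
    by (rule degree_le) (use assms in \<open>auto simp: coeff_sum_monom\<close>)
  then show ?thesis using assms by simp
qed

lemma sum_shifts:
  fixes P :: "int poly"
  shows "(\<Sum>i<a. smult (c i) (monom 1 i * P)) = (\<Sum>i<a. monom (c i) i) * P"
  by (simp add: sum_distrib_right smult_monom flip: mult_smult_left)

lemma degree_monom_mult_le:
  fixes P :: "int poly"
  shows "degree (monom 1 i * P) \<le> i + degree P"
  using degree_mult_le[of "monom 1 i" P] degree_monom_le[of "1 :: int" i] by linarith

lemma abs_power_le_max:
  fixes x :: real
  assumes "i \<le> N"
  shows "\<bar>x\<bar> ^ i \<le> max 1 \<bar>x\<bar> ^ N"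
proof -
  have "\<bar>x\<bar> ^ i \<le> max 1 \<bar>x\<bar> ^ i" by (intro power_mono) auto
  also have "\<dots> \<le> max 1 \<bar>x\<bar> ^ N" using assms by (intro power_increasing) auto
  finally show ?thesis .
qed

text \<open>
  The system of polynomials consists of \<open>a\<close> shifts of \<open>P\<close>, \<open>b\<close> shifts of \<open>Q\<close>, and, if \<open>e = 1\<close>,
  the single polynomial \<open>R\<close>.
\<close>
lemma one_le_shifts:
  fixes P Q R :: "int poly" and x :: real
  assumes N: "N = a + b + e" and ab: "0 < a" "0 < b" and e: "e \<le> 1"
    and deg: "degree P + a \<le> N" "degree Q + b \<le> N" "degree R < N"
    and indep: "\<And>A B c. A * P + B * Q + smult c R = 0 \<Longrightarrow> degree A < a \<Longrightarrow> degree B < b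
                  \<Longrightarrow> (e = 0 \<Longrightarrow> c = 0) \<Longrightarrow> A = 0 \<and> B = 0 \<and> c = 0"
    and pos: "0 < H" "0 < K" "0 < T"
    and ht: "height P \<le> H" "height Q \<le> K" "height R \<le> T"
    and L3: "\<bar>ev x R\<bar> \<le> max 1 \<bar>x\<bar> ^ N * L3"
  shows "1 \<le> fact N * max 1 \<bar>x\<bar> ^ N * (H ^ a * K ^ b * T ^ e) *
           (of_nat a * \<bar>ev x P\<bar> / H + of_nat b * \<bar>ev x Q\<bar> / K + of_nat e * L3 / T)"
proof -
  define M where "M = max 1 \<bar>x\<bar> ^ N"
  define L1 L2 where "L1 = \<bar>ev x P\<bar>" and "L2 = \<bar>ev x Q\<bar>"
  define f where "f i = (if i < a then monom 1 i * P else if i < a + b then monom 1 (i - a) * Q else R)" for i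
  define h where "h i = (if i < a then H else if i < a + b then K else T)" for i
  define l where "l i = M * (if i < a then L1 else if i < a + b then L2 else L3)" for i
  have sN: "(\<Sum>i<N. g i) = (\<Sum>i<a. g i) + (\<Sum>i<b. g (a + i)) + (\<Sum>i<e. g (a + b + i))"
    for g :: "nat \<Rightarrow> 'c :: comm_monoid_add"
    unfolding N by (simp add: sum_lessThan_add)
  have ev_shift: "\<bar>ev x (monom 1 i * S)\<bar> \<le> M * \<bar>ev x S\<bar>" if "i < N" for i and S :: "int poly"
    using mult_right_mono[OF abs_power_le_max[of i N x], of "\<bar>ev x S\<bar>"] that
    by (simp add: abs_mult power_abs M_def)
  have "1 \<le> fact N * (\<Prod>k<N. h k) * (\<Sum>i<N. l i / h i)"
  proof (rule one_le_independent[of N f h x l])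
    show "0 < N" using N ab by simp
    fix i assume i: "i < N"
    show "degree (f i) < N"
      using i deg ab degree_monom_mult_le[of i P] degree_monom_mult_le[of "i - a" Q]
      by (auto simp: f_def)
    show "0 < h i" using pos by (auto simp: h_def)
    show "height (f i) \<le> h i" using ht by (auto simp: f_def h_def height_monom_mult)
    show "\<bar>ev x (f i)\<bar> \<le> l i"
      using ev_shift[of i P] ev_shift[of "i - a" Q] L3 i by (auto simp: f_def l_def M_def L1_def L2_def)
  next
    fix c :: "nat \<Rightarrow> int"
    assume c: "(\<Sum>i<N. smult (c i) (f i)) = 0"
    define A where "A = (\<Sum>i<a. monom (c i) i)"
    define B where "B = (\<Sum>i<b. monom (c (a + i)) i)"
    \<comment> \<open>\<open>R\<close> has a row only for \<open>e = 1\<close>; for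
      \<open>e = 0\<close> the default 0 removes the term \<open>smult d R\<close>.\<close>
    define d where "d = (if e = 0 then 0 else c (a + b))"
    have e01: "e = 0 \<or> e = 1" using e by auto
    have "(\<Sum>i<N. smult (c i) (f i)) =
        (\<Sum>i<a. smult (c i) (monom 1 i * P)) + (\<Sum>i<b. smult (c (a + i)) (monom 1 i * Q)) + smult d R"
      unfolding sN using e01 by (auto simp: f_def d_def)
    then have "A * P + B * Q + smult d R = 0"
      using c by (simp add: sum_shifts A_def B_def)
    from indep[OF this] have z: "A = 0 \<and> B = 0 \<and> d = 0"
      using ab by (simp add: A_def B_def degree_sum_monom_less d_def)
    show "\<forall>i<N. c i = 0"
    proof (intro allI impI)
      fix i assume i: "i < N"
      have "c i = coeff A i" if "i < a" using that by (simp add: A_def coeff_sum_monom)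
      moreover have "c i = coeff B (i - a)" if "\<not> i < a" "i < a + b"
        using that by (simp add: B_def coeff_sum_monom)
      moreover have "c i = d" if "\<not> i < a + b"
      proof -
        have "i = a + b" "e = 1" using that i N e by auto
        then show ?thesis by (simp add: d_def)
      qed
      ultimately show "c i = 0" using z by (cases "i < a"; cases "i < a + b") auto
    qed
  qed
  also have "(\<Prod>k<N. h k) = H ^ a * K ^ b * T ^ e"
    unfolding N by (simp add: prod_lessThan_add h_def)
  also have "(\<Sum>i<N. l i / h i) = M * (of_nat a * L1 / H + of_nat b * L2 / K + of_nat e * L3 / T)"
    unfolding sN by (simp add: l_def h_def algebra_simps)
  finally show ?thesis by (simp add: M_def L1_def L2_def mult_ac)
qed

section \<open>Resultants, and determinants with a third polynomial\<close>

text \<open>In the factorial ring of integer polynomials \<open>P\<close> is prime. It divides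
  \<open>B * Q\<close> but not \<open>Q\<close>, hence it divides \<open>B\<close>, whose degree is
  too small unless \<open>B = 0\<close>.\<close>

lemma syzygy_trivial:
  fixes P Q A B :: "int poly"
  assumes P: "irreducible P" and Q: "\<not> P dvd Q" and eq: "A * P + B * Q = 0" and B: "degree B < degree P"
  shows "A = 0 \<and> B = 0"
proof -
  have "prime_elem P" using P by (rule irreducible_imp_prime_elem)
  have "B * Q = P * (- A)" using eq by (simp add: algebra_simps eq_neg_iff_add_eq_0)
  then have "P dvd B * Q" by (rule dvdI)
  then have "P dvd B" using prime_elem_dvd_multD[OF \<open>prime_elem P\<close>] Q by blast
  then have "B = 0" using B dvd_imp_degree_le by (metis not_le)
  moreover have "P \<noteq> 0" using P by auto
  ultimately show ?thesis using eq by simp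
qed

text \<open>The \<open>q\<close> shifts of \<open>P\<close> and \<open>degree P\<close> shifts of
  \<open>Q\<close> are the rows of a Sylvester matrix, with \<open>Q\<close> given the formal degree
  \<open>q\<close>. They admit only the trivial syzygy, so the determinant is a nonzero
  integer.\<close>

lemma resultant_bound:
  fixes P Q :: "int poly" and x :: real
  assumes P: "irreducible P" and Q: "\<not> P dvd Q" and p: "0 < degree P" and q: "degree Q \<le> q" "0 < q"
    and ht: "height P \<le> H" "height Q \<le> K" and pos: "0 < H" "0 < K"
  defines "N \<equiv> degree P + q"
  shows "1 \<le> fact N * max 1 \<bar>x\<bar> ^ N * (H ^ q * K ^ degree P) *
           (of_nat q * \<bar>ev x P\<bar> / H + of_nat (degree P) * \<bar>ev x Q\<bar> / K)"
proof -
  have "1 \<le> fact N * max 1 \<bar>x\<bar> ^ N * (H ^ q * K ^ degree P * 1 ^ 0) *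
           (of_nat q * \<bar>ev x P\<bar> / H + of_nat (degree P) * \<bar>ev x Q\<bar> / K + of_nat 0 * 1 / 1)"
  proof (rule one_le_shifts[where R = 1])
    show "height (1 :: int poly) \<le> 1" by (rule height_le) (simp add: coeff_pCons split: nat.splits)
    show "\<bar>ev x 1\<bar> \<le> max 1 \<bar>x\<bar> ^ N * 1" by simp
    show "A = 0 \<and> B = 0 \<and> c = 0"
      if "A * P + B * Q + smult c 1 = 0" "degree A < q" "degree B < degree P" "(0::nat) = 0 \<Longrightarrow> c = 0" for A B c
      using syzygy_trivial[OF P Q, of A B] that by auto
  qed (use assms in auto)
  then show ?thesis by simp
qed

text \<open>Composes two proportionalities with denominators cleared: formally, \<open>M\<close> is
  \<open>c / a\<close> times \<open>A\<close>, and \<open>X * A\<close> is \<open>a / b\<close>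
  times \<open>A'\<close>.\<close>

lemma smult_chain:
  fixes A A' M X :: "int poly"
  assumes "smult a M = smult c A" "smult b (X * A) = smult a A'" "a \<noteq> 0"
  shows "smult b (X * M) = smult c A'"
proof -
  have "smult a (smult b (X * M)) = smult b (X * smult a M)" by (simp add: mult_ac)
  also have "\<dots> = smult c (smult b (X * A))" unfolding assms(1) by (simp add: mult_ac)
  also have "\<dots> = smult a (smult c A')" unfolding assms(2) by (simp add: mult_ac)
  finally have "smult a (smult b (X * M) - smult c A') = 0" by (simp only: smult_diff_right)
  then show ?thesis using assms(3) by simp
qed

lemma ex_shift_independent:
  fixes P Q R :: "int poly"
  assumes P: "irreducible P" "degree P = n" and n: "n \<ge> 2" and Q: "\<not> P dvd Q"
    and R: "\<And>a b c. smult c R = smult a P + smult b Q \<Longrightarrow> c = 0"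
  shows "\<exists>s\<le>n - 2. \<forall>A B c. smult c (monom 1 s * R) = A * P + B * Q \<longrightarrow> degree A < n - 1
          \<longrightarrow> degree B < n - 1 \<longrightarrow> c = 0"
proof (rule ccontr)
  assume "\<not> ?thesis"
  then have "\<forall>s. \<exists>A B c. s \<le> n - 2 \<longrightarrow> smult c (monom 1 s * R) = A * P + B * Q \<and> degree A < n - 1
        \<and> degree B < n - 1 \<and> c \<noteq> 0" by blast
  then obtain A B c where ABc: "\<And>s. s \<le> n - 2 \<Longrightarrow> smult (c s) (monom 1 s * R) = A s * P + B s * Q \<and>
      degree (A s) < n - 1 \<and> degree (B s) < n - 1 \<and> c s \<noteq> 0" by metis
  text \<open>Representations with coefficients of degree less than \<open>n\<close> are unique, so multiplying one by
    \<open>X\<close> yields the next one up to a constant; the degree bound at \<open>s = n - 2\<close> then forces constant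
    coefficients at \<open>s = 0\<close>.\<close>
  have chain: "smult (c s) (monom 1 s * A 0) = smult (c 0) (A s) \<and>
               smult (c s) (monom 1 s * B 0) = smult (c 0) (B s)" if "s \<le> n - 2" for s
    using that
  proof (induction s)
    case 0
    then show ?case by simp
  next
    case (Suc s)
    let ?X = "monom 1 1 :: int poly"
    have m: "monom 1 (Suc s) = ?X * monom 1 s" by (simp add: mult_monom)
    have s: "smult (c s) (monom 1 s * R) = A s * P + B s * Q"
      and s': "smult (c (Suc s)) (monom 1 (Suc s) * R) = A (Suc s) * P + B (Suc s) * Q"
      using ABc[of s] ABc[of "Suc s"] Suc.prems by auto
    have "smult (c (Suc s)) (?X * smult (c s) (monom 1 s * R)) = smult (c s) (smult (c (Suc s)) (monom 1 (Suc s) * R))"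
      by (simp add: m mult_ac)
    then have "smult (c (Suc s)) (?X * (A s * P + B s * Q)) = smult (c s) (A (Suc s) * P + B (Suc s) * Q)"
      unfolding s s' .
    then have z: "(smult (c (Suc s)) (?X * A s) - smult (c s) (A (Suc s))) * P +
          (smult (c (Suc s)) (?X * B s) - smult (c s) (B (Suc s))) * Q = 0"
      by (simp add: algebra_simps smult_add_right)
    have d: "degree (smult (c (Suc s)) (?X * B s) - smult (c s) (B (Suc s))) < degree P"
    proof -
      have "degree (smult (c (Suc s)) (?X * B s)) \<le> n - 1"
        using ABc[of s] Suc.prems degree_monom_mult_le[of 1 "B s"] by (intro order.trans[OF degree_smult_le]) auto
      moreover have "degree (smult (c s) (B (Suc s))) \<le> n - 1"
        using ABc[of "Suc s"] Suc.prems by (intro order.trans[OF degree_smult_le]) auto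
      ultimately show ?thesis
        using degree_diff_le[of "smult (c (Suc s)) (?X * B s)" "n - 1" "smult (c s) (B (Suc s))"] P n by simp
    qed
    have e: "smult (c (Suc s)) (?X * A s) = smult (c s) (A (Suc s))"
        "smult (c (Suc s)) (?X * B s) = smult (c s) (B (Suc s))"
      using syzygy_trivial[OF P(1) Q z d] by simp_all
    have c0: "c s \<noteq> 0" using ABc[of s] Suc.prems by simp
    have IH: "smult (c s) (monom 1 s * A 0) = smult (c 0) (A s)"
             "smult (c s) (monom 1 s * B 0) = smult (c 0) (B s)"
      using Suc by auto
    show ?case
      unfolding m mult.assoc using smult_chain[OF IH(1) e(1) c0] smult_chain[OF IH(2) e(2) c0] by blast
  qed
  have const: "degree S = 0" if S: "smult (c (n - 2)) (monom 1 (n - 2) * S) = smult (c 0) S'"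
    and S': "degree S' < n - 1" for S S' :: "int poly"
  proof (cases "S = 0")
    case False
    have "degree (smult (c (n - 2)) (monom 1 (n - 2) * S)) = n - 2 + degree S"
      using ABc[of "n - 2"] False by (simp add: degree_mult_eq degree_monom_eq)
    moreover have "degree (smult (c 0) S') \<le> n - 2" using S' by (intro order.trans[OF degree_smult_le]) simp
    ultimately show ?thesis using S by simp
  qed simp
  have "degree (A 0) = 0" "degree (B 0) = 0"
    using const chain[of "n - 2"] ABc[of "n - 2"] by blast+
  then obtain a b where "A 0 = [:a:]" "B 0 = [:b:]" by (metis degree_eq_zeroE)
  then have "smult (c 0) R = smult a P + smult b Q" using ABc[of 0] by simp
  then show False using R ABc[of 0] by blast
qed

text \<open>\<open>R\<close> contributes a single row. The \<open>2n - 1\<close> rows are one fewer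
  than for the resultant of two polynomials of degree \<open>n\<close>, and \<open>T\<close> occurs
  only once in the product of heights.\<close>

lemma three_polys_bound:
  fixes P Q R :: "int poly" and x :: real
  assumes P: "irreducible P" "degree P = n" and n: "n \<ge> 2" and Q: "\<not> P dvd Q" "degree Q \<le> n" and R: "degree R \<le> n"
    and indep: "\<And>a b c. smult c R = smult a P + smult b Q \<Longrightarrow> c = 0"
    and ht: "height P \<le> H" "height Q \<le> K" "height R \<le> T" and pos: "0 < H" "0 < K" "0 < T"
  defines "N \<equiv> 2 * n - 1"
  shows "1 \<le> fact N * max 1 \<bar>x\<bar> ^ N * (H ^ (n - 1) * K ^ (n - 1) * T) *
           (of_nat (n - 1) * \<bar>ev x P\<bar> / H + of_nat (n - 1) * \<bar>ev x Q\<bar> / K + \<bar>ev x R\<bar> / T)"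
proof -
  have "\<exists>s\<le>n - 2. \<forall>A B c. smult c (monom 1 s * R) = A * P + B * Q \<longrightarrow> degree A < n - 1
          \<longrightarrow> degree B < n - 1 \<longrightarrow> c = 0"
    by (rule ex_shift_independent[OF P n Q(1)]) (rule indep)
  then obtain s where s: "s \<le> n - 2"
    and ind: "\<And>A B c. smult c (monom 1 s * R) = A * P + B * Q \<Longrightarrow> degree A < n - 1 \<Longrightarrow> degree B < n - 1 \<Longrightarrow> c = 0"
    by blast
  have "1 \<le> fact N * max 1 \<bar>x\<bar> ^ N * (H ^ (n - 1) * K ^ (n - 1) * T ^ 1) *
           (of_nat (n - 1) * \<bar>ev x P\<bar> / H + of_nat (n - 1) * \<bar>ev x Q\<bar> / K + of_nat 1 * \<bar>ev x R\<bar> / T)"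
  proof (rule one_le_shifts[where R = "monom 1 s * R"])
    show "degree (monom 1 s * R) < N" using degree_monom_mult_le[of s R] s R n by (simp add: N_def)
    show "height (monom 1 s * R) \<le> T" using ht by (simp add: height_monom_mult)
    show "\<bar>ev x (monom 1 s * R)\<bar> \<le> max 1 \<bar>x\<bar> ^ N * \<bar>ev x R\<bar>"
      using mult_right_mono[OF abs_power_le_max[of s N x], of "\<bar>ev x R\<bar>"] s n
      by (simp add: abs_mult power_abs N_def)
    show "A = 0 \<and> B = 0 \<and> c = 0"
      if eq: "A * P + B * Q + smult c (monom 1 s * R) = 0" and d: "degree A < n - 1" "degree B < n - 1" for A B c
    proof -
      have "smult c (monom 1 s * R) = (- A) * P + (- B) * Q"
        using eq by (simp add: algebra_simps eq_neg_iff_add_eq_0)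
      from ind[OF this] have "c = 0" using d by simp
      then show ?thesis using syzygy_trivial[OF P(1) Q(1), of A B] eq d P n by simp
    qed
  qed (use assms in auto)
  then show ?thesis by simp
qed

section \<open>Multiplicativity of the height\<close>

definition cheight :: "complex poly \<Rightarrow> real" where
  "cheight p = Max ((\<lambda>i. norm (coeff p i)) ` {..degree p})"

lemma cheight_coeff: "norm (coeff p i) \<le> cheight p"
proof (cases "i \<le> degree p")
  case True
  then show ?thesis unfolding cheight_def by (intro Max_ge) auto
next
  case False
  have "norm (coeff p 0) \<le> cheight p" unfolding cheight_def by (intro Max_ge) auto
  then have "0 \<le> cheight p" using norm_ge_zero[of "coeff p 0"] by linarith
  then show ?thesis using False by (simp add: coeff_eq_0)
qed

lemma cheight_le:
  assumes "\<And>i. norm (coeff p i) \<le> B"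
  shows "cheight p \<le> B"
  unfolding cheight_def using assms by (intro Max.boundedI) auto

lemma cheight_nonneg: "0 \<le> cheight p"
  using cheight_coeff[of p 0] norm_ge_zero[of "coeff p 0"] by linarith

lemma height_eq_cheight: "height p = cheight (of_int_poly p)"
  by (simp add: height_def cheight_def)

lemma cheight_linear_mult_le: "cheight ([:- a, 1:] * p) \<le> 2 * max 1 (norm a) * cheight p"
proof (rule cheight_le)
  fix i
  have "norm (coeff ([:- a, 1:] * p) i) \<le> norm a * norm (coeff p i) + norm (coeff (pCons 0 p) i)"
    using norm_triangle_ineq4[of "coeff (pCons 0 p) i" "a * coeff p i"] by (simp add: norm_mult)
  also have "\<dots> \<le> max 1 (norm a) * cheight p + 1 * cheight p"
    using cheight_coeff[of p] cheight_nonneg[of p]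
    by (intro add_mono mult_mono) (auto simp: coeff_pCons split: nat.splits)
  also have "\<dots> \<le> max 1 (norm a) * cheight p + max 1 (norm a) * cheight p"
    by (intro add_left_mono mult_right_mono cheight_nonneg) simp
  finally show "norm (coeff ([:- a, 1:] * p) i) \<le> 2 * max 1 (norm a) * cheight p" by (simp only: mult_2 distrib_right)
qed

text \<open>
  The coefficients of \<open>p\<close> are recovered from those of \<open>(X - a) p\<close> recursively, starting from the
  top if \<open>\<bar>a\<bar> \<le> 1\<close> and from the bottom otherwise.
\<close>
lemma cheight_linear_mult_ge:
  "max 1 (norm a) * cheight p \<le> of_nat (Suc (degree p)) * cheight ([:- a, 1:] * p)"
proof -
  define q where "q = [:- a, 1:] * p"
  define h where "h = cheight q"
  have h0: "0 \<le> h" by (simp add: h_def cheight_nonneg)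
  have c0: "coeff q 0 = - a * coeff p 0" by (simp add: q_def)
  have cS: "coeff q (Suc i) = coeff p i - a * coeff p (Suc i)" for i by (simp add: q_def)
  have qh: "norm (coeff q i) \<le> h" for i by (simp add: h_def cheight_coeff)
  show ?thesis
  proof (cases "norm a \<le> 1")
    case True
    have *: "norm (coeff p i) \<le> of_nat (Suc (degree p) - i) * h" if "i \<le> Suc (degree p)" for i
      using that
    proof (induction i rule: inc_induct)
      case base
      then show ?case by (simp add: coeff_eq_0)
    next
      case (step i)
      have "norm (coeff p i) \<le> norm (coeff q (Suc i)) + norm a * norm (coeff p (Suc i))"
        using norm_triangle_ineq[of "coeff q (Suc i)" "a * coeff p (Suc i)"] by (simp add: cS norm_mult)
      also have "\<dots> \<le> h + 1 * (of_nat (Suc (degree p) - Suc i) * h)"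
        using True step h0 qh by (intro add_mono mult_mono) auto
      also have "\<dots> = of_nat (Suc (degree p) - i) * h"
        using step(2) by (simp add: Suc_diff_le of_nat_diff algebra_simps)
      finally show ?case .
    qed
    have "cheight p \<le> of_nat (Suc (degree p)) * h"
    proof (rule cheight_le)
      fix i
      show "norm (coeff p i) \<le> of_nat (Suc (degree p)) * h"
      proof (cases "i \<le> Suc (degree p)")
        case i: True
        have "of_nat (Suc (degree p) - i) * h \<le> of_nat (Suc (degree p)) * h"
          using h0 by (intro mult_right_mono) auto
        then show ?thesis using *[OF i] by linarith
      next
        case False
        then show ?thesis using h0 by (simp add: coeff_eq_0)
      qed
    qed
    then show ?thesis using True by (simp add: h_def q_def max_absorb1)
  next
    case False
    then have a: "1 < norm a" by simp
    have *: "norm a * norm (coeff p i) \<le> of_nat (Suc i) * h" for i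
    proof (induction i)
      case 0
      then show ?case using qh[of 0] by (simp add: c0 norm_mult)
    next
      case (Suc i)
      have "norm a * norm (coeff p (Suc i)) \<le> norm (coeff q (Suc i)) + norm (coeff p i)"
        using norm_triangle_ineq4[of "coeff p i" "coeff q (Suc i)"] by (simp add: cS norm_mult)
      also have "norm (coeff p i) \<le> norm a * norm (coeff p i)"
        using a mult_right_mono[of 1 "norm a" "norm (coeff p i)"] by simp
      also have "\<dots> \<le> of_nat (Suc i) * h" by (rule Suc)
      finally show ?case using qh[of "Suc i"] by (simp add: algebra_simps)
    qed
    have "cheight p \<le> of_nat (Suc (degree p)) * h / norm a"
    proof (rule cheight_le)
      fix i
      show "norm (coeff p i) \<le> of_nat (Suc (degree p)) * h / norm a"
      proof (cases "i \<le> degree p")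
        case True
        have "of_nat (Suc i) * h \<le> of_nat (Suc (degree p)) * h"
          using h0 True by (intro mult_right_mono) auto
        then have "norm a * norm (coeff p i) \<le> of_nat (Suc (degree p)) * h" using *[of i] by linarith
        then show ?thesis using a by (subst pos_le_divide_eq) (auto simp: mult.commute)
      next
        case False
        then show ?thesis using h0 by (simp add: coeff_eq_0)
      qed
    qed
    then have "norm a * cheight p \<le> of_nat (Suc (degree p)) * h"
      using a by (subst (asm) pos_le_divide_eq) (auto simp: mult.commute)
    then show ?thesis using a by (simp add: h_def q_def max_absorb2)
  qed
qed

text \<open>Gelfond's inequality. The roots \<open>a\<close> of \<open>p\<close> are removed one at
  a time: passing from \<open>p'\<close> to \<open>p\<close> and from \<open>p' * q\<close> to
  \<open>p * q\<close> multiplies both heights by \<open>max 1 (norm a)\<close> up to bounded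
  factors, so this quantity cancels.\<close>

lemma cheight_mult_ge:
  assumes "degree p = m" "degree (p * q) \<le> d" "p \<noteq> 0" "q \<noteq> 0"
  shows "cheight p * cheight q \<le> (2 * real (Suc d)) ^ m * cheight (p * q)"
  using assms
proof (induction m arbitrary: p)
  case 0
  then obtain c where p: "p = [:c:]" by (metis degree_eq_zeroE)
  have "norm c * cheight q \<le> cheight (p * q)" if "c \<noteq> 0"
  proof -
    have "cheight q \<le> cheight (p * q) / norm c"
      using cheight_coeff[of "p * q"] that by (intro cheight_le) (simp add: p field_simps norm_mult)
    then show ?thesis using that by (simp add: field_simps)
  qed
  moreover have "cheight p = norm c" by (simp add: p cheight_def)
  ultimately show ?case using 0 p by simp
next
  case (Suc m)
  have "\<not> constant (poly p)" using Suc.prems by (simp add: constant_degree)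
  then obtain a where "poly p a = 0" using fundamental_theorem_of_algebra by blast
  then obtain p' where p: "p = [:- a, 1:] * p'" by (auto simp: poly_eq_0_iff_dvd)
  have nz: "p' \<noteq> 0" using Suc.prems p by auto
  have dp: "degree p' = m"
    using Suc.prems(1) nz unfolding p by (subst (asm) degree_mult_eq) auto
  have dpq: "Suc (degree (p' * q)) \<le> d"
    using Suc.prems(2,4) nz unfolding p mult.assoc by (subst (asm) degree_mult_eq) auto
  let ?M = "max 1 (norm a)"
  have "cheight p * cheight q \<le> 2 * ?M * (cheight p' * cheight q)"
    using mult_right_mono[OF cheight_linear_mult_le[of a p'] cheight_nonneg[of q]] by (simp add: p mult_ac)
  also have "\<dots> \<le> 2 * ?M * ((2 * real (Suc d)) ^ m * cheight (p' * q))"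
    using Suc.IH[of p'] dp dpq nz Suc.prems by (intro mult_left_mono) auto
  also have "\<dots> = (2 * real (Suc d)) ^ m * 2 * (?M * cheight (p' * q))" by simp
  also have "\<dots> \<le> (2 * real (Suc d)) ^ m * 2 * (of_nat (Suc (degree (p' * q))) * cheight ([:- a, 1:] * (p' * q)))"
    by (intro mult_left_mono cheight_linear_mult_ge) auto
  also have "\<dots> \<le> (2 * real (Suc d)) ^ m * 2 * (of_nat (Suc d) * cheight ([:- a, 1:] * (p' * q)))"
    using dpq by (intro mult_left_mono mult_right_mono cheight_nonneg) auto
  also have "\<dots> = (2 * real (Suc d)) ^ Suc m * cheight (p * q)" unfolding p power_Suc2 mult.assoc by simp
  finally show ?case .
qed

lemma height_mult_ge:
  "\<exists>G\<ge>1. \<forall>p q. p * q \<noteq> 0 \<longrightarrow> degree (p * q) \<le> n \<longrightarrow> height p * height q \<le> G * height (p * q)"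
proof (intro exI conjI allI impI)
  show "1 \<le> (2 * real (Suc n)) ^ n" by (rule one_le_power) simp
  fix p q :: "int poly" assume nz: "p * q \<noteq> 0" and d: "degree (p * q) \<le> n"
  have dp: "degree p \<le> n" using d nz by (subst (asm) degree_mult_eq) auto
  have m: "of_int_poly (p * q) = (of_int_poly p * of_int_poly q :: complex poly)"
    by (simp add: of_int_poly_hom.hom_mult)
  have "height p * height q \<le> (2 * real (Suc n)) ^ degree p * height (p * q)"
    unfolding height_eq_cheight m
    by (rule cheight_mult_ge) (use nz d in \<open>auto simp flip: m\<close>)
  also have "\<dots> \<le> (2 * real (Suc n)) ^ n * height (p * q)"
    by (intro mult_right_mono power_increasing dp height_nonneg) auto
  finally show "height p * height q \<le> (2 * real (Suc n)) ^ n * height (p * q)" .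
qed

section \<open>Polynomials of degree less than n\<close>

lemma ex_min_on_finite:
  fixes f :: "'a \<Rightarrow> real"
  assumes "finite S" "S \<noteq> {}"
  shows "\<exists>a\<in>S. \<forall>b\<in>S. f a \<le> f b"
proof -
  have "Min (f ` S) \<in> f ` S" using assms by (intro Min_in) auto
  then obtain a where "a \<in> S" "f a = Min (f ` S)" by auto
  then show ?thesis using assms by (metis Min_le finite_imageI imageI)
qed

lemma height_add_le: "height (p + q) \<le> height p + height q"
proof (rule height_le)
  fix i
  show "\<bar>of_int (coeff (p + q) i)\<bar> \<le> height p + height q"
    using height_coeff[of p i] height_coeff[of q i] by simp
qed

lemma powr_gap_tendsto_0:
  fixes u v D :: real
  assumes "u < v"
  shows "((\<lambda>h. D * h powr (u - v)) \<longlongrightarrow> 0) at_top"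
proof -
  have "((\<lambda>h :: real. h powr (u - v)) \<longlongrightarrow> 0) at_top"
    using assms by (intro tendsto_neg_powr) (auto intro: filterlim_ident)
  from tendsto_mult_right_zero[OF this] show ?thesis .
qed

text \<open>Dividing by the content leaves a primitive polynomial. Its factors of degree 0 are
  units, so reducibility yields two factors of positive degree.\<close>

lemma int_poly_decompose:
  fixes p :: "int poly"
  assumes "0 < degree p"
  obtains k q where "p = smult k q" "k \<noteq> 0" "irreducible q"
  | k a b where "p = smult k (a * b)" "k \<noteq> 0" "0 < degree a" "0 < degree b"
proof -
  define q where "q = primitive_part p"
  have p: "p = smult (content p) q" by (simp add: q_def)
  have nz: "content p \<noteq> 0" using assms by auto
  have q0: "q \<noteq> 0" using assms p by auto
  have "p \<noteq> 0" using assms by auto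
  then have cq: "content q = 1" by (simp add: q_def)
  have dq: "degree q = degree p" by (simp add: q_def)
  have const: "is_unit a" if a: "a dvd q" "degree a = 0" for a
  proof -
    obtain k where k: "a = [:k:]" using a(2) by (rule degree_eq_zeroE)
    have "[:k:] dvd q" using a(1) k by simp
    then have "k dvd content q" by (simp only: const_poly_dvd_iff_dvd_content)
    then show ?thesis unfolding k cq by (simp only: is_unit_const_poly_iff)
  qed
  show ?thesis
  proof (cases "irreducible q")
    case True
    then show ?thesis by (rule that(1)[OF p nz])
  next
    case False
    have "\<not> is_unit q" using dq assms by (auto simp: is_unit_poly_iff)
    then obtain a b where ab: "q = a * b" "\<not> is_unit a" "\<not> is_unit b"
      using False q0 by (auto simp: irreducible_def)
    then have "0 < degree a" "0 < degree b" using const[of a] const[of b] by auto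
    moreover have "p = smult (content p) (a * b)" using p ab(1) by simp
    ultimately show ?thesis using nz by (intro that(2))
  qed
qed

text \<open>An admissible exponent \<open>w\<close> beyond \<open>2n - 2\<close>, to be refuted for
  large \<open>w\<close>. By transcendence, \<open>p \<noteq> 0\<close> says the same as a nonzero
  value at \<open>x\<close>.\<close>

locale uniform_approximation =
  fixes n :: nat and x w :: real
  assumes n: "n \<ge> 3"
    and transcendental: "p \<noteq> 0 \<Longrightarrow> ev x p \<noteq> 0"
    and w: "w > 2 * real n - 2"
    and unif: "\<forall>\<^sub>F H in at_top. \<exists>p. p \<noteq> 0 \<and> degree p \<le> n \<and> height p \<le> H \<and> \<bar>ev x p\<bar> \<le> H powr (- w)"
begin

text \<open>Compare \<open>p\<close> with a solution \<open>q\<close> of the uniform system at a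
  slightly smaller height. Their resultant has at most \<open>2n - 1\<close> rows, so one of the two
  values is at least a constant times \<open>height p powr (2 - 2n)\<close>. Since
  \<open>w > v > 2n - 2\<close>, for large heights this cannot be the value of
  \<open>q\<close>.\<close>

lemma irreducible_lower_bound:
  assumes v: "2 * real n - 2 < v" "v < w"
  shows "\<exists>c>0. \<forall>p. irreducible p \<longrightarrow> 0 < degree p \<longrightarrow> degree p \<le> n - 1 \<longrightarrow>
           c * height p powr (- v) \<le> \<bar>ev x p\<bar>"
proof -
  obtain G where G: "G \<ge> 1" and
    Gm: "\<And>p q. p * q \<noteq> 0 \<Longrightarrow> degree (p * q) \<le> n \<Longrightarrow> height p * height q \<le> G * height (p * q)"
    using height_mult_ge[of n] by blast
  have w0: "w > 0" and v0: "v > 0" using w v n by auto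
  define D where "D = fact (2 * n) * max 1 \<bar>x\<bar> ^ (2 * n) * real n"
  have D0: "D > 0" using n by (simp add: D_def)
  obtain X0 where X0: "\<And>H. H \<ge> X0 \<Longrightarrow>
      \<exists>p. p \<noteq> 0 \<and> degree p \<le> n \<and> height p \<le> H \<and> \<bar>ev x p\<bar> \<le> H powr (- w)"
    using unif by (auto simp: eventually_at_top_linorder)
  have "\<forall>\<^sub>F h in at_top. D * (1 + (2 * G) powr w) * h powr (2 * real n - 2 - v) < 1"
    using powr_gap_tendsto_0[OF v(1), of "D * (1 + (2 * G) powr w)"] by (rule order_tendstoD) simp
  then obtain h1 where h1: "\<And>h. h \<ge> h1 \<Longrightarrow> D * (1 + (2 * G) powr w) * h powr (2 * real n - 2 - v) < 1"
    by (auto simp: eventually_at_top_linorder)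
  define h0 where "h0 = max h1 (2 * G * X0)"
  have large: "height p powr (- v) \<le> \<bar>ev x p\<bar>"
    if p: "irreducible p" "0 < degree p" "degree p \<le> n - 1" "height p \<ge> h0" for p
  proof (rule ccontr)
    assume "\<not> ?thesis"
    then have small: "\<bar>ev x p\<bar> < height p powr (- v)" by simp
    define h where "h = height p"
    have h: "h \<ge> 1" using height_ge_1[of p] p by (auto simp: h_def)
    \<comment> \<open>By Gelfond's inequality a nonzero multiple of \<open>p\<close> has height at
      least \<open>h / G\<close>. The extra factor 2 keeps \<open>q\<close> strictly below this, so
      \<open>p\<close> does not divide \<open>q\<close>.\<close>
    have "h / (2 * G) \<ge> X0" using p G by (simp add: h0_def h_def field_simps)
    from X0[OF this] obtain q where q: "q \<noteq> 0" "degree q \<le> n" "height q \<le> h / (2 * G)"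
      "\<bar>ev x q\<bar> \<le> (h / (2 * G)) powr (- w)" by blast
    have "G * height q \<le> h / 2" using q(3) G by (simp add: field_simps)
    then have Gq: "G * height q < h" using h by linarith
    have "\<not> p dvd q"
    proof
      assume "p dvd q"
      then obtain a where a: "q = p * a" by (rule dvdE)
      then have "height p * height a \<le> G * height q" using Gm[of p a] q by simp
      moreover have "height p * 1 \<le> height p * height a"
        using q a by (intro mult_left_mono height_ge_1 height_nonneg) auto
      ultimately show False using Gq by (simp add: h_def)
    qed
    have qh: "height q \<le> h"
      using Gq G mult_right_mono[of 1 G "height q"] height_nonneg[of q] by simp
    define N where "N = degree p + n"
    have N: "N \<le> 2 * n" "N - 1 \<le> 2 * n - 2" "N \<ge> 1" using p n by (auto simp: N_def)
    have "1 \<le> fact N * max 1 \<bar>x\<bar> ^ N * (h ^ n * h ^ degree p) *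
        (of_nat n * \<bar>ev x p\<bar> / h + of_nat (degree p) * \<bar>ev x q\<bar> / h)"
      unfolding N_def
      by (rule resultant_bound) (use p q qh h \<open>\<not> p dvd q\<close> n in \<open>auto simp: h_def\<close>)
    also have "h ^ n * h ^ degree p = h ^ (N - 1) * h"
      using N by (simp add: N_def add.commute flip: power_add power_Suc2)
    also have "fact N * max 1 \<bar>x\<bar> ^ N * (h ^ (N - 1) * h) * (of_nat n * \<bar>ev x p\<bar> / h + of_nat (degree p) * \<bar>ev x q\<bar> / h)
       = fact N * max 1 \<bar>x\<bar> ^ N * h ^ (N - 1) * (of_nat n * \<bar>ev x p\<bar> + of_nat (degree p) * \<bar>ev x q\<bar>)"
      using h by (simp add: field_simps)
    also have "\<dots> \<le> fact (2 * n) * max 1 \<bar>x\<bar> ^ (2 * n) * h ^ (2 * n - 2) *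
        (of_nat n * h powr (- v) + of_nat n * ((2 * G) powr w * h powr (- v)))"
    proof (intro mult_mono add_mono)
      show "\<bar>ev x p\<bar> \<le> h powr (- v)" using small by (simp add: h_def)
      have "(h / (2 * G)) powr (- w) = (2 * G) powr w * h powr (- w)"
        using h G by (simp add: powr_divide powr_minus field_simps)
      also have "\<dots> \<le> (2 * G) powr w * h powr (- v)"
        using v h by (intro mult_left_mono powr_mono) auto
      finally show "\<bar>ev x q\<bar> \<le> (2 * G) powr w * h powr (- v)" using q(4) by linarith
    qed (use N h p n in \<open>auto intro!: fact_mono power_increasing mult_nonneg_nonneg add_nonneg_nonneg\<close>)
    also have "\<dots> = D * (1 + (2 * G) powr w) * (h ^ (2 * n - 2) * h powr (- v))"
      by (simp add: D_def algebra_simps)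
    also have "h ^ (2 * n - 2) * h powr (- v) = h powr (2 * real n - 2 - v)"
    proof -
      have "h ^ (2 * n - 2) = h powr (2 * real n - 2)"
        using h n by (simp add: of_nat_diff flip: powr_realpow)
      then show ?thesis by (simp flip: powr_add)
    qed
    finally show False using h1[of h] p by (simp add: h0_def h_def)
  qed
  define S where "S = {p :: int poly. degree p \<le> n \<and> height p \<le> h0} - {0}"
  \<comment> \<open>\<open>S\<close> holds the finitely many exceptions of height at most
    \<open>h0\<close>. Inserting 1 keeps the set nonempty and gives
    \<open>c \<le> 1\<close>.\<close>
  define c where "c = Min (insert 1 ((\<lambda>p. \<bar>ev x p\<bar>) ` S))"
  have finS: "finite S" unfolding S_def using finite_int_polys_bounded[of n h0] by simp
  have "c \<in> insert 1 ((\<lambda>p. \<bar>ev x p\<bar>) ` S)" unfolding c_def using finS by (intro Min_in) auto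
  moreover have "\<forall>p\<in>S. \<bar>ev x p\<bar> > 0" using transcendental by (simp add: S_def)
  ultimately have c0: "c > 0" by auto
  have c1: "c \<le> 1" unfolding c_def using finS by (intro Min_le) auto
  have cS: "c \<le> \<bar>ev x p\<bar>" if "p \<in> S" for p unfolding c_def using finS that by (intro Min_le) auto
  have "c * height p powr (- v) \<le> \<bar>ev x p\<bar>" if p: "irreducible p" "0 < degree p" "degree p \<le> n - 1" for p
  proof -
    have hp: "height p \<ge> 1" using p by (intro height_ge_1) auto
    have pow1: "height p powr (- v) \<le> 1" using powr_mono[of "- v" 0 "height p"] hp v0 by simp
    show ?thesis
    proof (cases "height p \<ge> h0")
      case True
      then show ?thesis using large[OF p True] c1 mult_right_mono[of c 1 "height p powr (- v)"] by simp
    next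
      case False
      then have "p \<in> S" using p by (auto simp: S_def)
      then show ?thesis using cS[of p] mult_left_mono[OF pow1, of c] c0 by linarith
    qed
  qed
  then show ?thesis using c0 by blast
qed

text \<open>Induction on the degree. An integer factor only helps, and irreducible polynomials are
  settled. For a product the two lower bounds multiply, and Gelfond's inequality leads from the
  product of the heights back to the height of the product.\<close>

lemma lower_bound:
  assumes v: "2 * real n - 2 < v" "v < w" and m: "m \<le> n - 1"
  shows "\<exists>c>0. \<forall>p. p \<noteq> 0 \<longrightarrow> degree p \<le> m \<longrightarrow> c * height p powr (- v) \<le> \<bar>ev x p\<bar>"
  using m
proof (induction m)
  case 0
  have v0: "v > 0" using v n by auto
  have "1 * height p powr (- v) \<le> \<bar>ev x p\<bar>" if p: "p \<noteq> 0" "degree p \<le> 0" for p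
  proof -
    obtain k where k: "p = [:k:]" using p by (metis degree_eq_zeroE le_zero_eq)
    have "1 \<le> \<bar>k\<bar>" using p k by simp
    then have "1 \<le> \<bar>real_of_int k\<bar>" by linarith
    moreover have "height p powr (- v) \<le> 1"
      using powr_mono[of "- v" 0 "height p"] height_ge_1[OF p(1)] v0 by simp
    ultimately show ?thesis by (simp add: k)
  qed
  then show ?case by (intro exI[of _ 1]) simp
next
  case (Suc m)
  have v0: "v > 0" using v n by auto
  obtain c1 where c1: "c1 > 0" "\<And>p. p \<noteq> 0 \<Longrightarrow> degree p \<le> m \<Longrightarrow> c1 * height p powr (- v) \<le> \<bar>ev x p\<bar>"
    using Suc by auto
  obtain c2 where c2: "c2 > 0" "\<And>p. irreducible p \<Longrightarrow> 0 < degree p \<Longrightarrow> degree p \<le> n - 1 \<Longrightarrow>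
           c2 * height p powr (- v) \<le> \<bar>ev x p\<bar>"
    using irreducible_lower_bound[OF v] by blast
  obtain G where G: "G \<ge> 1" and
    Gm: "\<And>p q. p * q \<noteq> 0 \<Longrightarrow> degree (p * q) \<le> n \<Longrightarrow> height p * height q \<le> G * height (p * q)"
    using height_mult_ge[of n] by blast
  define c where "c = min (min c1 c2) (c1 * c1 * G powr (- v))"
  have c0: "c > 0" using c1 c2 G by (simp add: c_def)
  have scale: "c * height (smult k q) powr (- v) \<le> \<bar>ev x (smult k q)\<bar>"
    if le: "c * height q powr (- v) \<le> \<bar>ev x q\<bar>" and k: "k \<noteq> 0" and q: "q \<noteq> 0" for k q
  proof -
    have k1: "1 \<le> \<bar>real_of_int k\<bar>" using k by linarith
    have hq: "height q \<ge> 1" using q by (rule height_ge_1)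
    have "1 * height q \<le> height (smult k q)"
      unfolding height_smult using k1 hq by (intro mult_right_mono) auto
    then have "height (smult k q) powr (- v) \<le> height q powr (- v)"
      using hq v0 by (intro powr_mono2') auto
    then have "c * height (smult k q) powr (- v) \<le> c * height q powr (- v)"
      using c0 by (intro mult_left_mono) auto
    also have "\<dots> \<le> \<bar>ev x q\<bar>" by (rule le)
    also have "\<dots> \<le> \<bar>ev x (smult k q)\<bar>"
      using mult_right_mono[OF k1, of "\<bar>ev x q\<bar>"] by (simp add: abs_mult)
    finally show ?thesis .
  qed
  have "c * height p powr (- v) \<le> \<bar>ev x p\<bar>" if p: "p \<noteq> 0" "degree p \<le> Suc m" for p
  proof (cases "degree p = 0")
    case True
    have "c * height p powr (- v) \<le> c1 * height p powr (- v)" by (intro mult_right_mono) (auto simp: c_def)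
    then show ?thesis using c1(2)[of p] p True by simp
  next
    case False
    then have "0 < degree p" by simp
    then show ?thesis
    proof (cases p rule: int_poly_decompose)
      case (1 k q)
      have "c * height q powr (- v) \<le> c2 * height q powr (- v)" by (intro mult_right_mono) (auto simp: c_def)
      also have "\<dots> \<le> \<bar>ev x q\<bar>" using 1 p Suc.prems False by (intro c2(2)) auto
      finally show ?thesis unfolding 1(1) using 1 by (intro scale) auto
    next
      case (2 k a b)
      have nz: "a \<noteq> 0" "b \<noteq> 0" using 2 by auto
      have d: "degree a + degree b \<le> Suc m" using p 2 nz by (simp add: degree_mult_eq)
      have ha: "1 \<le> height a" "1 \<le> height b" "1 \<le> height (a * b)" using nz by (auto intro: height_ge_1)
      have "c * height (a * b) powr (- v) \<le> c1 * c1 * G powr (- v) * height (a * b) powr (- v)"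
        by (intro mult_right_mono) (auto simp: c_def)
      also have "\<dots> = c1 * c1 * (G * height (a * b)) powr (- v)"
        using G ha by (simp add: powr_mult)
      also have "\<dots> \<le> c1 * c1 * (height a * height b) powr (- v)"
      proof -
        have "degree (a * b) \<le> n" using d nz Suc.prems by (simp add: degree_mult_eq)
        then have "height a * height b \<le> G * height (a * b)" using Gm[of a b] nz by simp
        moreover have "0 < height a * height b" using ha by simp
        ultimately show ?thesis using c1 v0 by (intro mult_left_mono powr_mono2') auto
      qed
      also have "\<dots> = (c1 * height a powr (- v)) * (c1 * height b powr (- v))"
        using ha by (simp add: powr_mult)
      also have "\<dots> \<le> \<bar>ev x a\<bar> * \<bar>ev x b\<bar>"
        using c1 nz d 2 by (intro mult_mono) auto
      finally have "c * height (a * b) powr (- v) \<le> \<bar>ev x (a * b)\<bar>" by (simp add: abs_mult)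
      then show ?thesis unfolding 2(1) using 2 nz by (intro scale) auto
    qed
  qed
  then show ?case using c0 by blast
qed

section \<open>Existence of the sequence of minimal polynomials\<close>

text \<open>The successor of \<open>p\<close> has least height among the polynomials of smaller
  value than \<open>p\<close>, and least value among those of that height. Smaller values exist by
  \<open>unif\<close>, minima by finiteness.\<close>

lemma ex_minimal_polys:
  "\<exists>P :: nat \<Rightarrow> int poly. \<forall>i. P i \<noteq> 0 \<and> degree (P i) \<le> n \<and> height (P i) < height (P (Suc i)) \<and>
     \<bar>ev x (P (Suc i))\<bar> < \<bar>ev x (P i)\<bar> \<and>
     (\<forall>q. q \<noteq> 0 \<longrightarrow> degree q \<le> n \<longrightarrow> height q < height (P (Suc i)) \<longrightarrow> \<bar>ev x (P i)\<bar> \<le> \<bar>ev x q\<bar>)"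
proof -
  define A where "A = {q :: int poly. q \<noteq> 0 \<and> degree q \<le> n}"
  \<comment> \<open>This invariant forces a smaller value to come with a strictly larger
    height.\<close>
  define best where "best p \<longleftrightarrow> p \<in> A \<and> (\<forall>q\<in>A. height q \<le> height p \<longrightarrow> \<bar>ev x p\<bar> \<le> \<bar>ev x q\<bar>)" for p
  have finA: "finite {q \<in> A. height q \<le> B}" for B
    by (rule finite_subset[OF _ finite_int_polys_bounded[of n B]]) (auto simp: A_def)
  have "\<exists>P. \<forall>i. best (P i) \<and> (height (P i) < height (P (Suc i)) \<and> \<bar>ev x (P (Suc i))\<bar> < \<bar>ev x (P i)\<bar> \<and>
     (\<forall>q\<in>A. height q < height (P (Suc i)) \<longrightarrow> \<bar>ev x (P i)\<bar> \<le> \<bar>ev x q\<bar>))"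
  proof (rule dependent_nat_choice)
    have "1 \<in> {q \<in> A. height q \<le> height (1 :: int poly)}" by (simp add: A_def)
    then obtain p where "p \<in> {q \<in> A. height q \<le> height (1 :: int poly)}"
      "\<forall>q\<in>{q \<in> A. height q \<le> height (1 :: int poly)}. \<bar>ev x p\<bar> \<le> \<bar>ev x q\<bar>"
      using ex_min_on_finite[OF finA[of "height (1 :: int poly)"], of "\<lambda>q. \<bar>ev x q\<bar>"] by blast
    then show "\<exists>p. best p" by (auto simp: best_def)
  next
    fix p and i :: nat
    assume p: "best p"
    have ev0: "\<bar>ev x p\<bar> > 0" using p transcendental by (simp add: best_def A_def)
    define T where "T = {q \<in> A. \<bar>ev x q\<bar> < \<bar>ev x p\<bar>}"
    have "((\<lambda>H :: real. H powr (- w)) \<longlongrightarrow> 0) at_top"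
      using w n by (intro tendsto_neg_powr) (auto intro: filterlim_ident)
    then have "\<forall>\<^sub>F H in at_top. H powr (- w) < \<bar>ev x p\<bar>" using ev0 by (rule order_tendstoD)
    with unif have "\<forall>\<^sub>F H in at_top. \<exists>q. q \<in> T \<and> height q \<le> H"
    proof eventually_elim
      case (elim H)
      then obtain q where "q \<noteq> 0" "degree q \<le> n" "height q \<le> H" "\<bar>ev x q\<bar> < \<bar>ev x p\<bar>" by force
      then show ?case by (auto simp: T_def A_def)
    qed
    then obtain q1 where q1: "q1 \<in> T"
      using eventually_happens'[of "at_top :: real filter"] trivial_limit_at_top_linorder by blast
    have "finite {q \<in> T. height q \<le> height q1}" by (rule finite_subset[OF _ finA[of "height q1"]]) (auto simp: T_def)
    then obtain q0 where q0: "q0 \<in> {q \<in> T. height q \<le> height q1}"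
      "\<forall>q\<in>{q \<in> T. height q \<le> height q1}. height q0 \<le> height q"
      using ex_min_on_finite[of "{q \<in> T. height q \<le> height q1}" height] q1 by auto
    then have q0T: "q0 \<in> T" and q0min: "\<And>q. q \<in> T \<Longrightarrow> height q0 \<le> height q"
      by auto
    have "finite {q \<in> T. height q \<le> height q0}" by (rule finite_subset[OF _ finA[of "height q0"]]) (auto simp: T_def)
    then obtain r where r: "r \<in> {q \<in> T. height q \<le> height q0}"
      "\<forall>q\<in>{q \<in> T. height q \<le> height q0}. \<bar>ev x r\<bar> \<le> \<bar>ev x q\<bar>"
      using ex_min_on_finite[of "{q \<in> T. height q \<le> height q0}" "\<lambda>q. \<bar>ev x q\<bar>"] q0T by auto
    have rA: "r \<in> A" "\<bar>ev x r\<bar> < \<bar>ev x p\<bar>" "height r = height q0"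
      using r q0min[of r] by (auto simp: T_def)
    have "best r"
      unfolding best_def
    proof (intro conjI ballI impI rA)
      fix q assume q: "q \<in> A" "height q \<le> height r"
      show "\<bar>ev x r\<bar> \<le> \<bar>ev x q\<bar>"
      proof (cases "q \<in> T")
        case True
        then show ?thesis using r(2) q rA by auto
      next
        case False
        then show ?thesis using q rA by (auto simp: T_def)
      qed
    qed
    moreover have "height p < height r" using p rA by (force simp: best_def)
    moreover have "\<bar>ev x p\<bar> \<le> \<bar>ev x q\<bar>" if "q \<in> A" "height q < height r" for q
      using q0min[of q] that rA by (force simp: T_def)
    ultimately show "\<exists>r. best r \<and> (height p < height r \<and> \<bar>ev x r\<bar> < \<bar>ev x p\<bar> \<and>
        (\<forall>q\<in>A. height q < height r \<longrightarrow> \<bar>ev x p\<bar> \<le> \<bar>ev x q\<bar>))" using rA by blast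
  qed
  then obtain P where P: "\<And>i. best (P i) \<and> (height (P i) < height (P (Suc i)) \<and> \<bar>ev x (P (Suc i))\<bar> < \<bar>ev x (P i)\<bar> \<and>
     (\<forall>q\<in>A. height q < height (P (Suc i)) \<longrightarrow> \<bar>ev x (P i)\<bar> \<le> \<bar>ev x q\<bar>))" by blast
  have PA: "P i \<noteq> 0 \<and> degree (P i) \<le> n" for i using P[of i] by (simp add: best_def A_def)
  show ?thesis
  proof (intro exI[of _ P] allI)
    fix i
    show "P i \<noteq> 0 \<and> degree (P i) \<le> n \<and> height (P i) < height (P (Suc i)) \<and>
     \<bar>ev x (P (Suc i))\<bar> < \<bar>ev x (P i)\<bar> \<and>
     (\<forall>q. q \<noteq> 0 \<longrightarrow> degree q \<le> n \<longrightarrow> height q < height (P (Suc i)) \<longrightarrow> \<bar>ev x (P i)\<bar> \<le> \<bar>ev x q\<bar>)"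
      using P[of i] PA[of i] unfolding A_def by blast
  qed
qed

end

section \<open>Minimal polynomials\<close>

text \<open>Analogues of the convergents of a continued fraction: \<open>P i\<close> has least value
  among all nonzero polynomials of height below that of \<open>P (Suc i)\<close>.\<close>

locale minimal_polys = uniform_approximation +
  fixes P :: "nat \<Rightarrow> int poly"
  assumes P_nz: "P i \<noteq> 0" and P_deg: "degree (P i) \<le> n"
    and height_less: "height (P i) < height (P (Suc i))"
    and ev_less: "\<bar>ev x (P (Suc i))\<bar> < \<bar>ev x (P i)\<bar>"
    and minimal: "q \<noteq> 0 \<Longrightarrow> degree q \<le> n \<Longrightarrow> height q < height (P (Suc i)) \<Longrightarrow> \<bar>ev x (P i)\<bar> \<le> \<bar>ev x q\<bar>"
begin

abbreviation ht :: "nat \<Rightarrow> real" where "ht i \<equiv> height (P i)"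
abbreviation L :: "nat \<Rightarrow> real" where "L i \<equiv> \<bar>ev x (P i)\<bar>"

lemma ht_ge_1: "1 \<le> ht i"
  using P_nz by (rule height_ge_1)

lemma ht_mono: "i \<le> j \<Longrightarrow> ht i \<le> ht j"
  by (rule lift_Suc_mono_le[of ht]) (use height_less in \<open>auto intro: less_imp_le\<close>)

lemma L_antimono: "i \<le> j \<Longrightarrow> L j \<le> L i"
  by (rule lift_Suc_antimono_le[of L]) (use ev_less in \<open>auto intro: less_imp_le\<close>)

lemma L_pos: "0 < L i"
  using transcendental[OF P_nz[of i]] by simp

lemma ht_ge: "real i \<le> ht i"
proof (induction i)
  case 0
  then show ?case using ht_ge_1[of 0] by simp
next
  case (Suc i)
  obtain a where a: "ht i = of_int \<bar>coeff (P i) a\<bar>" using height_attained by blast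
  obtain b where b: "ht (Suc i) = of_int \<bar>coeff (P (Suc i)) b\<bar>" using height_attained by blast
  have "\<bar>coeff (P i) a\<bar> + 1 \<le> \<bar>coeff (P (Suc i)) b\<bar>" using height_less[of i] a b by linarith
  then have "ht i + 1 \<le> ht (Suc i)" unfolding a b by linarith
  then show ?case using Suc by simp
qed

lemma ht_at_top: "filterlim ht at_top sequentially"
  by (rule filterlim_at_top_mono[OF filterlim_real_sequentially]) (simp add: ht_ge)

text \<open>The uniform system is used at half the height of \<open>P (Suc i)\<close>. Its solution
  then has height strictly below \<open>ht (Suc i)\<close>, so minimality applies; the halving costs
  \<open>2 powr w\<close>.\<close>

lemma eventually_L_le: "\<forall>\<^sub>F i in sequentially. L i \<le> 2 powr w * ht (Suc i) powr (- w)"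
proof -
  obtain X0 where X0: "\<And>H. H \<ge> X0 \<Longrightarrow>
      \<exists>p. p \<noteq> 0 \<and> degree p \<le> n \<and> height p \<le> H \<and> \<bar>ev x p\<bar> \<le> H powr (- w)"
    using unif by (auto simp: eventually_at_top_linorder)
  have "\<forall>\<^sub>F i in sequentially. ht i \<ge> 2 * X0" using ht_at_top by (auto simp: filterlim_at_top)
  then show ?thesis
  proof eventually_elim
    case (elim i)
    have "ht (Suc i) / 2 \<ge> X0" using elim height_less[of i] by simp
    from X0[OF this] obtain q where q: "q \<noteq> 0" "degree q \<le> n" "height q \<le> ht (Suc i) / 2"
      "\<bar>ev x q\<bar> \<le> (ht (Suc i) / 2) powr (- w)" by blast
    have "height q < ht (Suc i)" using q(3) ht_ge_1[of "Suc i"] by simp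
    then have "L i \<le> \<bar>ev x q\<bar>" using q by (intro minimal)
    also have "\<dots> \<le> (ht (Suc i) / 2) powr (- w)" by (rule q)
    also have "\<dots> = 2 powr w * ht (Suc i) powr (- w)"
      using ht_ge_1[of "Suc i"] by (simp add: powr_divide powr_minus field_simps)
    finally show ?case .
  qed
qed

text \<open>Eventually \<open>L i\<close> is below the lower bound for degree less than
  \<open>n\<close>. This excludes a smaller degree directly, and a product of two nonconstant
  factors through Gelfond's inequality. A constant factor that is not a unit contradicts
  minimality.\<close>

lemma eventually_irreducible: "\<forall>\<^sub>F i in sequentially. irreducible (P i) \<and> degree (P i) = n"
proof -
  define v where "v = (2 * real n - 2 + w) / 2"
  have v: "2 * real n - 2 < v" "v < w" using w by (auto simp: v_def)
  have w0: "w > 0" and v0: "v > 0" using w v n by auto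
  obtain c where c: "c > 0" "\<And>p. p \<noteq> 0 \<Longrightarrow> degree p \<le> n - 1 \<Longrightarrow> c * height p powr (- v) \<le> \<bar>ev x p\<bar>"
    using lower_bound[OF v order_refl] by blast
  obtain G where G: "G \<ge> 1" and
    Gm: "\<And>p q. p * q \<noteq> 0 \<Longrightarrow> degree (p * q) \<le> n \<Longrightarrow> height p * height q \<le> G * height (p * q)"
    using height_mult_ge[of n] by blast
  define d where "d = min c (c * c * G powr (- v))"
  have d0: "d > 0" using c G by (simp add: d_def)
  have "((\<lambda>i. 2 powr w * ht i powr (v - w)) \<longlonglongrightarrow> 0)"
    using powr_gap_tendsto_0[OF v(2), of "2 powr w"] ht_at_top by (rule filterlim_compose)
  then have "\<forall>\<^sub>F i in sequentially. 2 powr w * ht i powr (v - w) < d"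
    using d0 by (rule order_tendstoD)
  with eventually_L_le have "\<forall>\<^sub>F i in sequentially. L i < d * ht i powr (- v)"
  proof eventually_elim
    case (elim i)
    note elim(1)
    also have "2 powr w * ht (Suc i) powr (- w) \<le> 2 powr w * ht i powr (- w)"
      using height_less[of i] ht_ge_1[of i] w0 by (intro mult_left_mono powr_mono2') auto
    also have "\<dots> = 2 powr w * ht i powr (v - w) * ht i powr (- v)"
      by (simp flip: powr_add)
    also have "\<dots> < d * ht i powr (- v)"
      using elim(2) ht_ge_1[of i] by (intro mult_strict_right_mono) auto
    finally show ?case .
  qed
  with eventually_ge_at_top[of 1] show ?thesis
  proof eventually_elim
    case (elim i)
    have deg: "degree (P i) = n"
    proof (rule ccontr)
      assume "degree (P i) \<noteq> n"
      then have "degree (P i) \<le> n - 1" using P_deg[of i] by simp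
      then have "c * ht i powr (- v) \<le> L i" using P_nz by (intro c)
      moreover have "d * ht i powr (- v) \<le> c * ht i powr (- v)" by (intro mult_right_mono) (auto simp: d_def)
      ultimately show False using elim by linarith
    qed
    have const: "is_unit a" if ab: "P i = a * b" "degree a = 0" for a b
    proof -
      obtain k where k: "a = [:k:]" using ab(2) by (rule degree_eq_zeroE)
      have Pk: "P i = smult k b" using ab k by simp
      have nz: "k \<noteq> 0" "b \<noteq> 0" using Pk P_nz[of i] by auto
      have "\<bar>k\<bar> = 1"
      proof (rule ccontr)
        assume "\<bar>k\<bar> \<noteq> 1"
        then have "2 \<le> \<bar>k\<bar>" using nz by linarith
        then have k2: "2 \<le> \<bar>real_of_int k\<bar>" by linarith
        \<comment> \<open>The quotient \<open>b\<close> has smaller height and value than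
          \<open>P i\<close>, whereas the predecessor \<open>P j\<close> has least value below the
          height of \<open>P i\<close>. Index 0 has no predecessor and is left out.\<close>
        obtain j where j: "i = Suc j" using elim(1) by (cases i) auto
        have "2 * height b \<le> ht i" unfolding Pk height_smult
          using k2 by (intro mult_right_mono height_nonneg) auto
        moreover have "2 * \<bar>ev x b\<bar> \<le> L i" unfolding Pk ev_smult abs_mult
          using k2 by (intro mult_right_mono) auto
        moreover have "degree b \<le> n" using P_deg[of i] Pk nz by simp
        moreover have "1 \<le> height b" using nz by (intro height_ge_1)
        ultimately have "L j \<le> \<bar>ev x b\<bar>" using nz by (intro minimal) (auto simp: j)
        then show False using \<open>2 * \<bar>ev x b\<bar> \<le> L i\<close> ev_less[of j] j by simp
      qed
      then show ?thesis by (simp add: k is_unit_const_poly_iff)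
    qed
    have "irreducible (P i)"
    proof (rule irreducibleI)
      show "P i \<noteq> 0" by (rule P_nz)
      show "\<not> is_unit (P i)" using deg n by (auto simp: is_unit_poly_iff)
      fix a b assume ab: "P i = a * b"
      show "is_unit a \<or> is_unit b"
      proof (cases "degree a = 0 \<or> degree b = 0")
        case True
        then show ?thesis using const[of a b] const[of b a] ab by (auto simp: mult.commute)
      next
        case False
        have nz: "a \<noteq> 0" "b \<noteq> 0" using ab P_nz[of i] by auto
        have "degree a + degree b = n" using deg ab nz by (simp add: degree_mult_eq)
        then have dab: "degree a \<le> n - 1" "degree b \<le> n - 1" using False by auto
        have hab: "1 \<le> height a" "1 \<le> height b" using nz by (auto intro: height_ge_1)
        have "d * ht i powr (- v) \<le> c * c * G powr (- v) * ht i powr (- v)"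
          by (intro mult_right_mono) (auto simp: d_def)
        also have "\<dots> = c * c * (G * ht i) powr (- v)"
          using G ht_ge_1[of i] by (simp add: powr_mult)
        also have "\<dots> \<le> c * c * (height a * height b) powr (- v)"
        proof -
          have "height a * height b \<le> G * ht i" using Gm[of a b] ab P_nz[of i] P_deg[of i] by simp
          moreover have "0 < height a * height b" using hab by simp
          ultimately show ?thesis using c v0 by (intro mult_left_mono powr_mono2') auto
        qed
        also have "\<dots> = (c * height a powr (- v)) * (c * height b powr (- v))"
          using hab by (simp add: powr_mult)
        also have "\<dots> \<le> \<bar>ev x a\<bar> * \<bar>ev x b\<bar>"
          using c nz dab by (intro mult_mono) auto
        finally show ?thesis using elim by (simp add: ab abs_mult)
      qed
    qed
    then show ?case using deg by simp
  qed
qed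

text \<open>By degrees the quotient would be a nonzero integer, and an integer multiple of
  \<open>P i\<close> cannot have a smaller value.\<close>

lemma not_dvd_Suc:
  assumes "degree (P i) = n"
  shows "\<not> P i dvd P (Suc i)"
proof
  assume "P i dvd P (Suc i)"
  then obtain a where a: "P (Suc i) = P i * a" by (rule dvdE)
  have nz: "a \<noteq> 0" using a P_nz[of "Suc i"] by auto
  have "degree a = 0" using P_deg[of "Suc i"] assms nz P_nz[of i] by (simp add: a degree_mult_eq)
  then obtain k where k: "a = [:k:]" by (rule degree_eq_zeroE)
  have "1 \<le> \<bar>k\<bar>" using nz k by simp
  then have "1 \<le> \<bar>real_of_int k\<bar>" by linarith
  then have "L i \<le> L (Suc i)" using mult_left_mono[of 1 "\<bar>real_of_int k\<bar>" "L i"] by (simp add: a k abs_mult mult.commute)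
  then show False using ev_less[of i] by simp
qed

section \<open>Runs of minimal polynomials in one plane\<close>

text \<open>Asking for \<open>c \<noteq> 0\<close> is enough: \<open>P j\<close> and
  \<open>P (Suc j)\<close> are never proportional, since the height rises while the value
  falls.\<close>

definition dependent :: "nat \<Rightarrow> bool" where
  "dependent j \<longleftrightarrow> (\<exists>a b c. c \<noteq> 0 \<and> smult c (P (Suc (Suc j))) = smult a (P j) + smult b (P (Suc j)))"

text \<open>Consecutive minimal polynomials form a basis of the integer points in the plane they span.\<close>
lemma dependent_integral:
  assumes "dependent j"
  obtains a b where "a \<noteq> 0" "P (Suc (Suc j)) = smult a (P j) + smult b (P (Suc j))"
proof -
  obtain a b c where c: "c \<noteq> 0" and eq: "smult c (P (Suc (Suc j))) = smult a (P j) + smult b (P (Suc j))"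
    using assms by (auto simp: dependent_def)
  have round_int: "\<exists>q. 2 * \<bar>t - c * q\<bar> \<le> \<bar>c\<bar>" for t
  proof -
    define q where "q = round (real_of_int t / real_of_int c)"
    have "\<bar>real_of_int q - real_of_int t / real_of_int c\<bar> \<le> 1 / 2"
      unfolding q_def using of_int_round_abs_le .
    then have "\<bar>real_of_int c\<bar> * \<bar>real_of_int q - real_of_int t / real_of_int c\<bar> \<le> \<bar>real_of_int c\<bar> * (1 / 2)"
      by (intro mult_left_mono) auto
    also have "\<bar>real_of_int c\<bar> * \<bar>real_of_int q - real_of_int t / real_of_int c\<bar> = \<bar>real_of_int (t - c * q)\<bar>"
      using c by (simp add: algebra_simps abs_minus_commute flip: abs_mult)
    finally have "real_of_int (2 * \<bar>t - c * q\<bar>) \<le> real_of_int \<bar>c\<bar>" by simp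
    then have "2 * \<bar>t - c * q\<bar> \<le> \<bar>c\<bar>" by (simp only: of_int_le_iff)
    then show ?thesis by blast
  qed
  obtain a' where a': "2 * \<bar>a - c * a'\<bar> \<le> \<bar>c\<bar>" using round_int by blast
  obtain b' where b': "2 * \<bar>b - c * b'\<bar> \<le> \<bar>c\<bar>" using round_int by blast
  define r s where "r = a - c * a'" and "s = b - c * b'"
  \<comment> \<open>After rounding, \<open>S\<close> has coordinates of size at most 1/2 with
    respect to \<open>P j\<close> and \<open>P (Suc j)\<close>. Its height is thus below
    \<open>ht (Suc j)\<close> and its value below \<open>L j\<close>, so minimality forces
    \<open>S = 0\<close>.\<close>
  define S where "S = P (Suc (Suc j)) - smult a' (P j) - smult b' (P (Suc j))"
  have cS: "smult c S = smult r (P j) + smult s (P (Suc j))"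
    unfolding S_def smult_diff_right eq r_def s_def by (simp add: smult_diff_left)
  have rs: "\<bar>real_of_int r\<bar> \<le> \<bar>real_of_int c\<bar> / 2" "\<bar>real_of_int s\<bar> \<le> \<bar>real_of_int c\<bar> / 2"
  proof -
    have "real_of_int (2 * \<bar>r\<bar>) \<le> real_of_int \<bar>c\<bar>" "real_of_int (2 * \<bar>s\<bar>) \<le> real_of_int \<bar>c\<bar>"
      unfolding of_int_le_iff using a' b' by (simp_all add: r_def s_def)
    then show "\<bar>real_of_int r\<bar> \<le> \<bar>real_of_int c\<bar> / 2" "\<bar>real_of_int s\<bar> \<le> \<bar>real_of_int c\<bar> / 2" by simp_all
  qed
  have c0: "\<bar>real_of_int c\<bar> > 0" using c by simp
  have "S = 0"
  proof (rule ccontr)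
    assume S: "S \<noteq> 0"
    have "\<bar>real_of_int c\<bar> * height S \<le> \<bar>real_of_int r\<bar> * ht j + \<bar>real_of_int s\<bar> * ht (Suc j)"
      using height_add_le[of "smult r (P j)" "smult s (P (Suc j))"] by (simp add: height_smult flip: cS)
    also have "\<dots> \<le> \<bar>real_of_int c\<bar> / 2 * ht j + \<bar>real_of_int c\<bar> / 2 * ht (Suc j)"
      by (intro add_mono mult_right_mono rs height_nonneg)
    also have "\<dots> = \<bar>real_of_int c\<bar> * ((ht j + ht (Suc j)) / 2)" by (simp add: algebra_simps)
    finally have "height S \<le> (ht j + ht (Suc j)) / 2" using c0 by simp
    then have hS: "height S < ht (Suc j)" using height_less[of j] by simp
    have "degree S \<le> n"
      unfolding S_def by (intro degree_diff_le order.trans[OF degree_smult_le] P_deg)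
    then have LS: "L j \<le> \<bar>ev x S\<bar>" using minimal[OF S _ hS] by blast
    have "of_int c * ev x S = of_int r * ev x (P j) + of_int s * ev x (P (Suc j))"
      using arg_cong[OF cS, of "ev x"] by simp
    then have "\<bar>real_of_int c\<bar> * \<bar>ev x S\<bar> = \<bar>of_int r * ev x (P j) + of_int s * ev x (P (Suc j))\<bar>"
      by (simp flip: abs_mult)
    also have "\<dots> \<le> \<bar>real_of_int r\<bar> * L j + \<bar>real_of_int s\<bar> * L (Suc j)"
      by (rule order.trans[OF abs_triangle_ineq]) (simp add: abs_mult)
    also have "\<dots> \<le> \<bar>real_of_int c\<bar> / 2 * L j + \<bar>real_of_int c\<bar> / 2 * L (Suc j)"
      by (intro add_mono mult_right_mono rs) auto
    also have "\<dots> = \<bar>real_of_int c\<bar> * ((L j + L (Suc j)) / 2)" by (simp add: algebra_simps)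
    finally have "\<bar>ev x S\<bar> \<le> (L j + L (Suc j)) / 2" using c0 by simp
    then show False using LS ev_less[of j] by simp
  qed
  then have P2: "P (Suc (Suc j)) = smult a' (P j) + smult b' (P (Suc j))" by (simp add: S_def algebra_simps)
  have "a' \<noteq> 0"
  proof
    assume "a' = 0"
    then have P2': "P (Suc (Suc j)) = smult b' (P (Suc j))" using P2 by simp
    then have "b' \<noteq> 0" using P_nz[of "Suc (Suc j)"] by auto
    then have "1 \<le> \<bar>real_of_int b'\<bar>" by linarith
    then have "L (Suc j) \<le> L (Suc (Suc j))"
      using mult_right_mono[of 1 "\<bar>real_of_int b'\<bar>" "L (Suc j)"] by (simp add: P2' abs_mult)
    then show False using ev_less[of "Suc j"] by simp
  qed
  then show ?thesis using P2 that by blast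
qed

text \<open>
  The coefficients of \<open>P\<^sub>j(x) P\<^sub>j\<^sub>+\<^sub>1 - P\<^sub>j\<^sub>+\<^sub>1(x) P\<^sub>j\<close>, a substitute for the covolume of the lattice
  spanned by \<open>P\<^sub>j\<close> and \<open>P\<^sub>j\<^sub>+\<^sub>1\<close>.
\<close>
definition wedge :: "nat \<Rightarrow> nat \<Rightarrow> real" where
  "wedge j m = ev x (P j) * of_int (coeff (P (Suc j)) m) - ev x (P (Suc j)) * of_int (coeff (P j) m)"

text \<open>The change from the pair at \<open>j\<close> to the pair at \<open>Suc j\<close> has
  determinant \<open>- a\<close>, a nonzero integer, and \<open>wedge\<close> is multiplied by
  it.\<close>

lemma wedge_Suc_ge:
  assumes "dependent j"
  shows "\<bar>wedge j m\<bar> \<le> \<bar>wedge (Suc j) m\<bar>"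
proof -
  obtain a b where a: "a \<noteq> 0" and P2: "P (Suc (Suc j)) = smult a (P j) + smult b (P (Suc j))"
    using assms by (rule dependent_integral)
  have "wedge (Suc j) m = - of_int a * wedge j m"
    unfolding wedge_def P2 by (simp add: algebra_simps)
  then have "\<bar>wedge (Suc j) m\<bar> = \<bar>real_of_int a\<bar> * \<bar>wedge j m\<bar>" by (simp add: abs_mult)
  moreover have "1 \<le> \<bar>real_of_int a\<bar>" using a by linarith
  ultimately show ?thesis using mult_right_mono[of 1 "\<bar>real_of_int a\<bar>" "\<bar>wedge j m\<bar>"] by simp
qed

lemma wedge_le: "\<bar>wedge j m\<bar> \<le> 2 * L j * ht (Suc j)"
proof -
  have "\<bar>wedge j m\<bar> \<le> L j * \<bar>of_int (coeff (P (Suc j)) m)\<bar> + L (Suc j) * \<bar>of_int (coeff (P j) m)\<bar>"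
    unfolding wedge_def by (rule order.trans[OF abs_triangle_ineq4]) (simp add: abs_mult)
  also have "\<dots> \<le> L j * ht (Suc j) + L j * ht (Suc j)"
    using height_coeff[of "P j" m] height_less[of j] ev_less[of j]
    by (intro add_mono mult_mono height_coeff) auto
  finally show ?thesis by (simp add: mult_ac)
qed

text \<open>If \<open>L (Suc j)\<close> is at most half of \<open>L j\<close>, the first term
  dominates at the largest coefficient of \<open>P (Suc j)\<close>. Otherwise align the signs of the
  values and subtract \<open>P j\<close>, which does not change the alternating expression. The
  difference has value below \<open>L j / 2\<close>, so by minimality its height is at least
  \<open>ht (Suc j)\<close>.\<close>

lemma ex_wedge_ge: "\<exists>m. L j * ht (Suc j) / 2 \<le> \<bar>wedge j m\<bar>"
proof -
  define \<sigma> :: int where "\<sigma> = (if ev x (P j) * ev x (P (Suc j)) > 0 then 1 else - 1)"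
  define u v where "u = P j" and "v = smult \<sigma> (P (Suc j))"
  have s1: "\<bar>real_of_int \<sigma>\<bar> = 1" by (simp add: \<sigma>_def)
  have wedge: "\<bar>wedge j m\<bar> = \<bar>ev x u * of_int (coeff v m) - ev x v * of_int (coeff u m)\<bar>" for m
    unfolding wedge_def u_def v_def by (simp add: \<sigma>_def abs_minus_commute)
  have hu: "height u = ht j" and hv: "height v = ht (Suc j)"
    and Lu: "\<bar>ev x u\<bar> = L j" and Lv: "\<bar>ev x v\<bar> = L (Suc j)"
    using s1 by (simp_all add: u_def v_def height_smult abs_mult)
  have sgn: "ev x u * ev x v \<ge> 0" by (auto simp: u_def v_def \<sigma>_def)
  have X: "\<bar>ev x v\<bar> < \<bar>ev x u\<bar>" using ev_less[of j] by (simp add: Lu Lv)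
  have diff: "\<bar>ev x v - ev x u\<bar> = \<bar>ev x u\<bar> - \<bar>ev x v\<bar>"
    using sgn X by (auto simp: zero_le_mult_iff)
  show ?thesis
  proof (cases "\<bar>ev x v\<bar> \<le> \<bar>ev x u\<bar> / 2")
    case True
    obtain m where m: "height v = of_int \<bar>coeff v m\<bar>" using height_attained by blast
    have "\<bar>ev x v * of_int (coeff u m)\<bar> \<le> L j * ht (Suc j) / 2"
      unfolding abs_mult times_divide_eq_left[symmetric] Lu[symmetric] using True height_coeff[of u m] height_less[of j] hu by (intro mult_mono) auto
    moreover have "\<bar>ev x u * of_int (coeff v m)\<bar> = L j * ht (Suc j)" using m hv Lu by (simp add: abs_mult)
    ultimately have "L j * ht (Suc j) / 2 \<le> \<bar>wedge j m\<bar>" unfolding wedge by linarith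
    then show ?thesis by blast
  next
    case False
    define d where "d = v - u"
    have evd: "\<bar>ev x d\<bar> < \<bar>ev x u\<bar> / 2" "\<bar>ev x d\<bar> > 0" using diff False X by (auto simp: d_def)
    have dnz: "d \<noteq> 0" using evd by auto
    have degd: "degree d \<le> n"
      unfolding d_def u_def v_def by (intro degree_diff_le order.trans[OF degree_smult_le] P_deg)
    have hd: "ht (Suc j) \<le> height d"
      using minimal[OF dnz degd, of j] evd Lu by (cases "height d < ht (Suc j)") auto
    obtain m where m: "height d = of_int \<bar>coeff d m\<bar>" using height_attained by blast
    have "ev x u * of_int (coeff v m) - ev x v * of_int (coeff u m)
        = ev x u * of_int (coeff d m) - ev x d * of_int (coeff u m)"
      by (simp add: d_def algebra_simps)
    moreover have "\<bar>ev x d * of_int (coeff u m)\<bar> \<le> L j * ht (Suc j) / 2"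
      unfolding abs_mult times_divide_eq_left[symmetric] Lu[symmetric] using evd height_coeff[of u m] height_less[of j] hu by (intro mult_mono) auto
    moreover have "\<bar>ev x u * of_int (coeff d m)\<bar> \<ge> L j * ht (Suc j)"
      using m hd Lu by (simp add: abs_mult mult_left_mono)
    ultimately have "L j * ht (Suc j) / 2 \<le> \<bar>wedge j m\<bar>" unfolding wedge by linarith
    then show ?thesis by blast
  qed
qed

text \<open>A coefficient \<open>m\<close> at which \<open>wedge i\<close> is large stays large
  along the run. The factor 4 comes from the 1/2 in the lower bound and the 2 in the upper
  one.\<close>

lemma covolume_le:
  assumes "i \<le> k" "\<And>j. i \<le> j \<Longrightarrow> j < k \<Longrightarrow> dependent j"
  shows "L i * ht (Suc i) \<le> 4 * (L k * ht (Suc k))"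
proof -
  obtain m where m: "L i * ht (Suc i) / 2 \<le> \<bar>wedge i m\<bar>" using ex_wedge_ge by blast
  have "\<bar>wedge i m\<bar> \<le> \<bar>wedge k m\<bar>"
    using assms
  proof (induction k rule: dec_induct)
    case (step k)
    then show ?case using wedge_Suc_ge[of k m] by force
  qed simp
  then show ?thesis using m wedge_le[of k m] by linarith
qed

text \<open>All consecutive pairs of a run span the same plane. Going down from \<open>k\<close>,
  the polynomial \<open>P i\<close> is rewritten through its two successors, after multiplication by
  \<open>a'\<close> in place of a division.\<close>

lemma independent_plane:
  assumes "i \<le> k" "\<And>j. i \<le> j \<Longrightarrow> j < k \<Longrightarrow> dependent j" "\<not> dependent k"
    and "smult c (P (Suc (Suc k))) = smult a (P i) + smult b (P (Suc i))"
  shows "c = 0"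
  using assms(1,2,4)
proof (induction i arbitrary: a b c rule: inc_induct)
  case base
  show ?case
  proof (rule ccontr)
    assume "c \<noteq> 0"
    then have "dependent k"
      unfolding dependent_def by (intro exI[of _ a] exI[of _ b] exI[of _ c] conjI base.prems(2))
    then show False using assms(3) by simp
  qed
next
  case (step i)
  have "dependent i" by (rule step.prems(1)) (use step.hyps in auto)
  then obtain a' b' where a': "a' \<noteq> 0" and P2: "P (Suc (Suc i)) = smult a' (P i) + smult b' (P (Suc i))"
    by (rule dependent_integral)
  have "smult (a' * c) (P (Suc (Suc k))) = smult a' (smult c (P (Suc (Suc k))))" by simp
  also have "\<dots> = smult (a' * b - a * b') (P (Suc i)) + smult a (P (Suc (Suc i)))"
    unfolding step.prems(2) P2 by (rule poly_eqI) (simp add: algebra_simps)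
  finally have eq: "smult (a' * c) (P (Suc (Suc k))) = smult (a' * b - a * b') (P (Suc i)) + smult a (P (Suc (Suc i)))" .
  have "a' * c = 0" by (rule step.IH[OF _ eq]) (use step.prems(1) in auto)
  then show ?case using a' by simp
qed

end

section \<open>The exponent\<close>

text \<open>\<open>x\<close> stands for the logarithms of the end heights. With
  \<open>t = (w - n) / (n - 1)\<close>, hypothesis \<open>s\<close> reads
  \<open>1 / t < t + 1\<close>, which puts the convex function below \<open>w\<close> at the right
  end \<open>1 / t\<close>; \<open>w > 2 * n - 2\<close> does so at the left end 1.\<close>

lemma no_such_growth:
  fixes x :: "nat \<Rightarrow> real" and n w C :: real
  assumes n: "n \<ge> 3" and w: "w > 2 * n - 2" and s: "((w - n) / (n - 1))\<^sup>2 + (w - n) / (n - 1) > 1"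
    and mono: "\<And>j. x j \<le> x (Suc j)" and lim: "filterlim x at_top sequentially"
    and up: "\<And>j. (w - n) * x (Suc j) \<le> (n - 1) * x j + C"
    and tri: "\<And>j. w * x (Suc j) \<le> (n - 1) * x (Suc j) + (n - 2) * x j + x (Suc (Suc j)) + C"
  shows False
proof -
  \<comment> \<open>Both conditions on \<open>w\<close> are open, so some smaller \<open>v\<close>
    satisfies them too; later \<open>(w - v) * x j\<close> absorbs \<open>C\<close>.\<close>
  have "\<exists>v<w. v > 2 * n - 2 \<and> ((v - n) / (n - 1))\<^sup>2 + (v - n) / (n - 1) > 1"
  proof -
    have "((\<lambda>v. ((v - n) / (n - 1))\<^sup>2 + (v - n) / (n - 1)) \<longlongrightarrow> ((w - n) / (n - 1))\<^sup>2 + (w - n) / (n - 1)) (at_left w)"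
      using n by (intro tendsto_intros) auto
    then have "\<forall>\<^sub>F v in at_left w. ((v - n) / (n - 1))\<^sup>2 + (v - n) / (n - 1) > 1"
      using s by (rule order_tendstoD)
    moreover have "\<forall>\<^sub>F v in at_left w. v \<in> {2 * n - 2<..<w}"
      using w by (rule eventually_at_left_real)
    ultimately have "\<forall>\<^sub>F v in at_left w. v < w \<and> v > 2 * n - 2 \<and> ((v - n) / (n - 1))\<^sup>2 + (v - n) / (n - 1) > 1"
      by eventually_elim auto
    then show ?thesis using eventually_happens'[of "at_left w"] by (auto simp: trivial_limit_at_left_real)
  qed
  then obtain v where v: "v < w" "v > 2 * n - 2" and sv: "((v - n) / (n - 1))\<^sup>2 + (v - n) / (n - 1) > 1"
    by blast
  define B where "B = (n - 1) / (v - n)"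
  have vn: "v - n > 0" using v n by linarith
  have B0: "B > 0" using vn n by (simp add: B_def)
  define \<delta> where "\<delta> = min (v - (2 * n - 2)) (v - ((n - 2) / B + n - 1 + B))"
  have FB: "(n - 2) / B + n - 1 + B < v"
  proof -
    define t where "t = (v - n) / (n - 1)"
    have t: "t > 0" "B = 1 / t" "v = n + (n - 1) * t" using vn n by (simp_all add: t_def B_def)
    have "t * (t + 1) > 1" using sv by (simp add: t_def power2_eq_square algebra_simps)
    then have "1 / t < t + 1" using t(1) by (simp add: field_simps)
    then show ?thesis unfolding t(2) using t(3) by (simp add: algebra_simps)
  qed
  have d0: "\<delta> > 0" using FB v by (simp add: \<delta>_def)
  have convex: "(n - 2) / r + n - 1 + r \<le> v - \<delta>" if r: "1 \<le> r" "r \<le> B" for r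
  proof -
    define M where "M = v - \<delta> - (n - 1)"
    have M: "n - 2 + 1 \<le> M" "(n - 2) / B + B \<le> M" by (simp_all add: M_def \<delta>_def)
    have "(n - 2) + B * B \<le> M * B" using M(2) B0 by (simp add: field_simps)
    moreover have "(n - 2) + r * r - M * r \<le> 0"
    proof (cases "B = 1")
      case True
      then show ?thesis using r M by simp
    next
      case False
      then have B1: "B - 1 > 0" using r by linarith
      \<comment> \<open>Convexity made explicit: the chord of the quadratic over
        \<open>[1, B]\<close> minus the nonnegative excess \<open>(B - r) * (r - 1)\<close>, all
        multiplied by \<open>B - 1\<close>.\<close>
      have "(B - 1) * ((n - 2) + r * r - M * r)
         = (B - r) * (n - 2 + 1 - M) + (r - 1) * ((n - 2) + B * B - M * B) - (B - 1) * (B - r) * (r - 1)"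
        by (simp add: algebra_simps)
      also have "\<dots> \<le> 0"
      proof -
        have "(B - r) * (n - 2 + 1 - M) \<le> 0" using r M by (intro mult_nonneg_nonpos) auto
        moreover have "(r - 1) * ((n - 2) + B * B - M * B) \<le> 0"
          using r calculation \<open>(n - 2) + B * B \<le> M * B\<close> by (intro mult_nonneg_nonpos) auto
        moreover have "(B - 1) * (B - r) * (r - 1) \<ge> 0" using r B1 by (intro mult_nonneg_nonneg) auto
        ultimately show ?thesis by linarith
      qed
      finally show ?thesis using B1 by (simp add: mult_le_0_iff)
    qed
    ultimately have "(n - 2) / r + r \<le> M" using r by (simp add: field_simps)
    then show ?thesis by (simp add: M_def)
  qed
  have "\<forall>\<^sub>F j in sequentially. x j \<ge> max 1 (C / (w - v))"
    using lim by (auto simp: filterlim_at_top simp del: max.bounded_iff)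
  then obtain J where J: "\<And>j. j \<ge> J \<Longrightarrow> x j \<ge> max 1 (C / (w - v))"
    by (auto simp: eventually_sequentially)
  have pos: "x j > 0" and big: "C \<le> (w - v) * x j" if "j \<ge> J" for j
    using J[OF that] v by (auto simp: field_simps)
  define r where "r j = x (Suc j) / x j" for j
  have r1: "1 \<le> r j" if "j \<ge> J" for j using mono[of j] pos[OF that] by (simp add: r_def)
  have rB: "r j \<le> B" if "j \<ge> J" for j
  proof -
    have "(v - n) * x (Suc j) \<le> (n - 1) * x j"
      using up[of j] big[of "Suc j"] that by (simp add: algebra_simps)
    then show ?thesis using pos[OF that] vn by (simp add: r_def B_def field_simps)
  qed
  have step: "r (Suc j) \<ge> r j + \<delta>" if j: "j \<ge> J" for j
  proof -
    have p: "x j > 0" "x (Suc j) > 0" using pos j by auto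
    have "v * x (Suc j) \<le> (n - 1) * x (Suc j) + (n - 2) * x j + x (Suc (Suc j))"
      using tri[of j] big[of "Suc j"] j by (simp add: algebra_simps)
    then have "v \<le> ((n - 1) * x (Suc j) + (n - 2) * x j + x (Suc (Suc j))) / x (Suc j)"
      using p by (simp add: field_simps)
    also have "\<dots> = (n - 1) + (n - 2) / r j + r (Suc j)" using p by (simp add: r_def field_simps)
    finally show ?thesis using convex[OF r1[OF j] rB[OF j]] by linarith
  qed
  have grow: "r (J + k) \<ge> real k * \<delta>" for k
  proof (induction k)
    case 0
    then show ?case using r1[of J] by simp
  next
    case (Suc k)
    then show ?case using step[of "J + k"] by (simp add: algebra_simps)
  qed
  obtain k :: nat where "real k * \<delta> > B" using d0 reals_Archimedean3 by blast
  then show False using grow[of k] rB[of "J + k"] by simp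
qed

section \<open>Growth of the heights at the ends of the runs\<close>

context minimal_polys
begin

text \<open>In an endless run \<open>L i * ht (Suc i)\<close> would be at most
  \<open>4 * (L k * ht (Suc k))\<close> for all later \<open>k\<close>, and this tends to 0 because
  \<open>w > 1\<close>.\<close>

lemma ex_not_dependent: "\<exists>k\<ge>i. \<not> dependent k"
proof (rule ccontr)
  assume "\<not> ?thesis"
  then have dep: "dependent j" if "i \<le> j" for j using that by blast
  have "((\<lambda>k. 2 powr w * ht k powr (1 - w)) \<longlonglongrightarrow> 0)"
  proof (rule filterlim_compose[OF powr_gap_tendsto_0 ht_at_top])
    show "1 < w" using w n by linarith
  qed
  then have "((\<lambda>k. 2 powr w * ht (Suc k) powr (1 - w)) \<longlonglongrightarrow> 0)"
    by (subst filterlim_sequentially_Suc)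
  then have "\<forall>\<^sub>F k in sequentially. 2 powr w * ht (Suc k) powr (1 - w) < L i * ht (Suc i) / 4"
    by (rule order_tendstoD) (use L_pos[of i] ht_ge_1[of "Suc i"] in auto)
  with eventually_L_le eventually_ge_at_top[of i]
  have "\<forall>\<^sub>F k in sequentially. False"
  proof eventually_elim
    case (elim k)
    have "L i * ht (Suc i) \<le> 4 * (L k * ht (Suc k))" using elim dep by (intro covolume_le) auto
    also have "\<dots> \<le> 4 * (2 powr w * ht (Suc k) powr (- w) * ht (Suc k))"
      using elim ht_ge_1[of "Suc k"] by (intro mult_left_mono mult_right_mono) auto
    also have "\<dots> = 4 * (2 powr w * ht (Suc k) powr (1 - w))"
      using ht_ge_1[of "Suc k"] by (simp add: powr_diff powr_minus field_simps)
    also have "\<dots> < L i * ht (Suc i)" using elim by simp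
    finally show False by simp
  qed
  then show False by simp
qed

text \<open>
  Here \<open>P\<^sub>i, \<dots>, P\<^sub>k\<^sub>+\<^sub>1\<close> lie in one plane and \<open>P\<^sub>k\<^sub>+\<^sub>2\<close> does not. The resultant of \<open>P\<^sub>i, P\<^sub>i\<^sub>+\<^sub>1\<close> gives
  the first estimate and the triple \<open>P\<^sub>i, P\<^sub>i\<^sub>+\<^sub>1, P\<^sub>k\<^sub>+\<^sub>2\<close> the second. The planarity provides an
  upper bound for \<open>L i\<close> in terms of the possibly much larger height \<open>ht (k + 1)\<close>.
\<close>
lemma height_estimates:
  "\<exists>D>0. \<forall>\<^sub>F i in sequentially. \<forall>k\<ge>i. (\<forall>j. i \<le> j \<longrightarrow> j < k \<longrightarrow> dependent j) \<longrightarrow> \<not> dependent k \<longrightarrow>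
     1 \<le> D * ht i ^ (n - 1) * ht (Suc k) ^ (n - 1) * ht (Suc k) powr (1 - w) \<and>
     1 \<le> D * ht i ^ (n - 2) * ht (Suc k) ^ (n - 2) * ht (Suc k) powr (1 - w) * ht (Suc (Suc k))"
proof -
  define M where "M = fact (2 * n) * max 1 \<bar>x\<bar> ^ (2 * n)"
  define D where "D = M * (2 * real n) * (4 * 2 powr w)"
  have M0: "M > 0" by (simp add: M_def less_max_iff_disj)
  have D0: "D > 0" using M0 n by (simp add: D_def)
  have "\<forall>\<^sub>F i in sequentially. \<forall>k\<ge>i. L k \<le> 2 powr w * ht (Suc k) powr (- w)"
    using eventually_L_le by (auto simp: eventually_sequentially intro: order.trans)
  with eventually_irreducible have "\<forall>\<^sub>F i in sequentially. \<forall>k\<ge>i. (\<forall>j. i \<le> j \<longrightarrow> j < k \<longrightarrow> dependent j) \<longrightarrow> \<not> dependent k \<longrightarrow>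
     1 \<le> D * ht i ^ (n - 1) * ht (Suc k) ^ (n - 1) * ht (Suc k) powr (1 - w) \<and>
     1 \<le> D * ht i ^ (n - 2) * ht (Suc k) ^ (n - 2) * ht (Suc k) powr (1 - w) * ht (Suc (Suc k))"
  proof eventually_elim
    case (elim i)
    show ?case
    proof (intro allI impI)
      fix k assume k: "i \<le> k" and dep: "\<forall>j. i \<le> j \<longrightarrow> j < k \<longrightarrow> dependent j" and nd: "\<not> dependent k"
      define H K T where "H = ht i" and "K = ht (Suc i)" and "T = ht (Suc (Suc k))"
      define U where "U = ht (Suc k)"
      have pos: "0 < H" "0 < K" "0 < T" "0 < U"
        using ht_ge_1[of i] ht_ge_1[of "Suc i"] ht_ge_1[of "Suc (Suc k)"] ht_ge_1[of "Suc k"]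
        by (auto simp: H_def K_def T_def U_def)
      have HKT: "H \<le> K" "H \<le> T" "K \<le> U" using k by (auto simp: H_def K_def T_def U_def intro!: ht_mono)
      have irr: "irreducible (P i)" "degree (P i) = n" using elim by auto
      have LK: "L i * K \<le> 4 * 2 powr w * U powr (1 - w)"
      proof -
        have "L i * K \<le> 4 * (L k * U)" unfolding K_def U_def using k dep by (intro covolume_le) auto
        also have "\<dots> \<le> 4 * (2 powr w * U powr (- w) * U)"
          using elim k pos by (intro mult_left_mono mult_right_mono) (auto simp: U_def)
        also have "\<dots> = 4 * 2 powr w * U powr (1 - w)"
          using pos by (simp add: powr_diff powr_minus field_simps)
        finally show ?thesis .
      qed
      \<comment> \<open>Values fall and heights rise along the sequence, so no row has a larger
        quotient of value by height than the first.\<close>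
      have ratio: "L j / B \<le> L i / H" if "i \<le> j" "H \<le> B" for j B
        using that L_antimono[of i j] pos by (intro frac_le) auto
      have Hn: "H ^ (n - 1) = H ^ (n - 2) * H" "K ^ (n - 1) = K ^ (n - 2) * K" "H ^ n = H ^ (n - 1) * H" "K ^ n = K ^ (n - 1) * K"
      proof -
        have "n - 1 = Suc (n - 2)" "n = Suc (n - 1)" using n by auto
        then show "H ^ (n - 1) = H ^ (n - 2) * H" "K ^ (n - 1) = K ^ (n - 2) * K" "H ^ n = H ^ (n - 1) * H" "K ^ n = K ^ (n - 1) * K"
          by (metis power_Suc2)+
      qed
      have "1 \<le> fact (degree (P i) + n) * max 1 \<bar>x\<bar> ^ (degree (P i) + n) * (H ^ n * K ^ degree (P i)) *
          (of_nat n * L i / H + of_nat (degree (P i)) * L (Suc i) / K)"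
        by (rule resultant_bound) (use irr not_dvd_Suc P_deg n pos in \<open>auto simp: H_def K_def\<close>)
      also have "\<dots> = M * (H ^ n * K ^ n) * (real n * (L i / H) + real n * (L (Suc i) / K))"
        by (simp add: irr M_def mult_2)
      also have "\<dots> \<le> M * (H ^ n * K ^ n) * (real n * (L i / H) + real n * (L i / H))"
        using M0 pos HKT by (intro mult_left_mono add_left_mono ratio) auto
      \<comment> \<open>One factor \<open>K\<close> stays beside \<open>L i\<close> to form the
        product bounded by \<open>LK\<close>.\<close>
      also have "\<dots> = M * (2 * real n) * H ^ (n - 1) * K ^ (n - 1) * (L i * K)"
        using pos by (simp add: Hn(3,4) field_simps)
      also have "\<dots> \<le> M * (2 * real n) * H ^ (n - 1) * U ^ (n - 1) * (4 * 2 powr w * U powr (1 - w))"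
        using M0 pos HKT by (intro mult_mono LK power_mono) auto
      also have "\<dots> = D * H ^ (n - 1) * U ^ (n - 1) * U powr (1 - w)" by (simp add: D_def)
      finally have first: "1 \<le> D * H ^ (n - 1) * U ^ (n - 1) * U powr (1 - w)" .
      have indep: "c = 0" if "smult c (P (Suc (Suc k))) = smult a (P i) + smult b (P (Suc i))" for a b c
        by (rule independent_plane[OF k _ nd that]) (use dep in auto)
      have "1 \<le> fact (2 * n - 1) * max 1 \<bar>x\<bar> ^ (2 * n - 1) * (H ^ (n - 1) * K ^ (n - 1) * T) *
          (of_nat (n - 1) * L i / H + of_nat (n - 1) * L (Suc i) / K + L (Suc (Suc k)) / T)"
        by (rule three_polys_bound[OF irr _ _ _ _ indep])
          (use irr not_dvd_Suc P_deg n pos in \<open>auto simp: H_def K_def T_def\<close>)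
      also have "\<dots> = fact (2 * n - 1) * max 1 \<bar>x\<bar> ^ (2 * n - 1) * (H ^ (n - 1) * K ^ (n - 1) * T) *
          (of_nat (n - 1) * (L i / H) + of_nat (n - 1) * (L (Suc i) / K) + L (Suc (Suc k)) / T)"
        by simp
      also have "\<dots> \<le> M * (H ^ (n - 1) * K ^ (n - 1) * T) *
          (of_nat (n - 1) * (L i / H) + of_nat (n - 1) * (L i / H) + L i / H)"
      proof -
        have "fact (2 * n - 1) * max 1 \<bar>x\<bar> ^ (2 * n - 1) \<le> M"
          unfolding M_def by (intro mult_mono fact_mono power_increasing) auto
        then show ?thesis
          using M0 pos HKT k
          by (intro mult_mono[OF mult_right_mono] add_mono mult_left_mono ratio) auto
      qed
      also have "\<dots> \<le> M * (H ^ (n - 1) * K ^ (n - 1) * T) * (2 * real n * (L i / H))"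
      proof -
        have "of_nat (n - 1) * (L i / H) + of_nat (n - 1) * (L i / H) + L i / H = (2 * real n - 1) * (L i / H)"
        proof -
          have "real (n - 1) = real n - 1" using n by simp
          then show ?thesis by (simp only: left_diff_distrib mult_1 mult_2 distrib_right)
        qed
        also have "\<dots> \<le> 2 * real n * (L i / H)" using pos by (intro mult_right_mono) auto
        finally show ?thesis using M0 pos by (intro mult_left_mono) auto
      qed
      also have "\<dots> = M * (2 * real n) * H ^ (n - 2) * K ^ (n - 2) * (L i * K) * T"
        unfolding Hn(1,2) using pos by (simp add: field_simps)
      also have "\<dots> \<le> M * (2 * real n) * H ^ (n - 2) * U ^ (n - 2) * (4 * 2 powr w * U powr (1 - w)) * T"
        using M0 pos HKT by (intro mult_mono LK power_mono) auto
      also have "\<dots> = D * H ^ (n - 2) * U ^ (n - 2) * U powr (1 - w) * T" by (simp add: D_def)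
      finally show "1 \<le> D * ht i ^ (n - 1) * ht (Suc k) ^ (n - 1) * ht (Suc k) powr (1 - w) \<and>
          1 \<le> D * ht i ^ (n - 2) * ht (Suc k) ^ (n - 2) * ht (Suc k) powr (1 - w) * ht (Suc (Suc k))"
        using first by (simp add: H_def U_def T_def)
    qed
  qed
  then show ?thesis using D0 by blast
qed

lemma no_large_exponent:
  assumes s: "((w - n) / (n - 1))\<^sup>2 + (w - n) / (n - 1) > 1"
  shows False
proof -
  obtain D J where D: "D > 0" and est: "\<And>i k. J \<le> i \<Longrightarrow> i \<le> k \<Longrightarrow>
      (\<And>j. i \<le> j \<Longrightarrow> j < k \<Longrightarrow> dependent j) \<Longrightarrow> \<not> dependent k \<Longrightarrow>
     1 \<le> D * ht i ^ (n - 1) * ht (Suc k) ^ (n - 1) * ht (Suc k) powr (1 - w) \<and>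
     1 \<le> D * ht i ^ (n - 2) * ht (Suc k) ^ (n - 2) * ht (Suc k) powr (1 - w) * ht (Suc (Suc k))"
    using height_estimates unfolding eventually_sequentially by metis
  define nx where "nx i = (LEAST k. i \<le> k \<and> \<not> dependent k)" for i
  have nx: "i \<le> nx i" "\<not> dependent (nx i)" for i
    using LeastI_ex[of "\<lambda>k. i \<le> k \<and> \<not> dependent k"] ex_not_dependent[of i] by (auto simp: nx_def)
  have nx_least: "dependent j" if "i \<le> j" "j < nx i" for i j
    using not_less_Least[of j "\<lambda>k. i \<le> k \<and> \<not> dependent k"] that by (auto simp: nx_def)
  \<comment> \<open>The run that starts at \<open>e m\<close> ends at \<open>e (Suc m)\<close>,
    where the next one starts, so consecutive planes share a polynomial.\<close>
  define e where "e m = ((\<lambda>i. Suc (nx i)) ^^ m) J" for m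
  have eS: "e (Suc m) = Suc (nx (e m))" for m by (simp add: e_def)
  have eJ: "J \<le> e m" for m
  proof (induction m)
    case (Suc m)
    then show ?case using nx(1)[of "e m"] by (simp add: eS)
  qed (simp add: e_def)
  have e_less: "e m < e (Suc m)" for m using nx(1)[of "e m"] by (simp add: eS)
  define y where "y m = ln (ht (e m))" for m
  have h0: "0 < ht i" for i using ht_ge_1[of i] by simp
  show False
  proof (rule no_such_growth[of "real n" w y "ln D"])
    show "3 \<le> real n" "2 * real n - 2 < w" using n w by auto
    show "1 < ((w - real n) / (real n - 1))\<^sup>2 + (w - real n) / (real n - 1)" using s n by (simp add: of_nat_diff)
    show "y m \<le> y (Suc m)" for m
      using ht_mono[of "e m" "e (Suc m)"] e_less[of m] h0 by (simp add: y_def)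
    show "filterlim y at_top sequentially"
    proof -
      have "strict_mono e" using e_less by (simp add: strict_mono_Suc_iff)
      then have "filterlim e at_top sequentially" by (rule filterlim_subseq)
      then have "filterlim (\<lambda>m. ht (e m)) at_top sequentially" by (rule filterlim_compose[OF ht_at_top])
      then show ?thesis unfolding y_def by (rule filterlim_compose[OF ln_at_top])
    qed
    fix m
    have est1: "1 \<le> D * ht (e m) ^ (n - 1) * ht (e (Suc m)) ^ (n - 1) * ht (e (Suc m)) powr (1 - w)"
      and est2: "1 \<le> D * ht (e m) ^ (n - 2) * ht (e (Suc m)) ^ (n - 2) * ht (e (Suc m)) powr (1 - w) * ht (Suc (e (Suc m)))"
      using est[OF eJ[of m] nx(1) nx_least nx(2)] by (auto simp: eS)
    have "0 \<le> ln (D * ht (e m) ^ (n - 1) * ht (e (Suc m)) ^ (n - 1) * ht (e (Suc m)) powr (1 - w))"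
      using est1 by (rule ln_ge_zero)
    also have "\<dots> = ln D + (real n - 1) * y m + (real n - 1) * y (Suc m) + (1 - w) * y (Suc m)"
      using D n by (simp add: ln_mult ln_realpow ln_powr y_def h0 h0[THEN less_imp_neq, symmetric] of_nat_diff)
    finally show "(w - real n) * y (Suc m) \<le> (real n - 1) * y m + ln D" by (simp add: algebra_simps)
    have "0 \<le> ln (D * ht (e m) ^ (n - 2) * ht (e (Suc m)) ^ (n - 2) * ht (e (Suc m)) powr (1 - w) * ht (Suc (e (Suc m))))"
      using est2 by (rule ln_ge_zero)
    also have "\<dots> = ln D + (real n - 2) * y m + (real n - 2) * y (Suc m) + (1 - w) * y (Suc m) + ln (ht (Suc (e (Suc m))))"
      using D n by (simp add: ln_mult ln_realpow ln_powr y_def h0 h0[THEN less_imp_neq, symmetric] of_nat_diff)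
    \<comment> \<open>The polynomial that leaves the plane is the second of the next run, so its
      height is at most the end height of that run.\<close>
    also have "ln (ht (Suc (e (Suc m)))) \<le> y (Suc (Suc m))"
      using ht_mono[of "Suc (e (Suc m))" "e (Suc (Suc m))"] e_less[of "Suc m"] h0 by (simp add: y_def)
    finally show "w * y (Suc m) \<le> (real n - 1) * y (Suc m) + (real n - 2) * y m + y (Suc (Suc m)) + ln D"
      by (simp add: algebra_simps)
  qed
qed

end

lemma (in uniform_approximation) exponent_bound:
  "\<not> ((w - n) / (n - 1))\<^sup>2 + (w - n) / (n - 1) > 1"
proof
  assume s: "((w - n) / (n - 1))\<^sup>2 + (w - n) / (n - 1) > 1"
  obtain P where P: "\<forall>i. P i \<noteq> 0 \<and> degree (P i) \<le> n \<and> height (P i) < height (P (Suc i)) \<and>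
     \<bar>ev x (P (Suc i))\<bar> < \<bar>ev x (P i)\<bar> \<and>
     (\<forall>q. q \<noteq> 0 \<longrightarrow> degree q \<le> n \<longrightarrow> height q < height (P (Suc i)) \<longrightarrow> \<bar>ev x (P i)\<bar> \<le> \<bar>ev x q\<bar>)"
    using ex_minimal_polys by blast
  interpret minimal_polys n x w P
    by unfold_locales (use P in auto)
  show False using s by (rule no_large_exponent)
qed

section \<open>Return to real polynomials and conclusion\<close>

lemma naive_height_of_int_poly: "naive_height (of_int_poly p) = height p"
  by (simp add: naive_height_def height_def)

lemma int_polys_uptoE:
  assumes "Q \<in> int_polys_upto n"
  obtains p where "Q = of_int_poly p" "degree p \<le> n"
proof -
  have "coeff Q i = of_int (\<lfloor>coeff Q i\<rfloor>)" for i
    using assms by (auto simp: int_polys_upto_def elim!: Ints_cases)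
  then have "Q = of_int_poly (map_poly floor Q)" by (intro poly_eqI) (simp add: coeff_map_poly)
  then show ?thesis using that[of "map_poly floor Q"] assms
    by (metis (mono_tags, lifting) int_polys_upto_def mem_Collect_eq of_int_hom.degree_map_poly_hom)
qed

text \<open>Isolates the numerical condition on \<open>w\<close>, the point where
  \<open>n = 3\<close> and \<open>n \<ge> 4\<close> differ.\<close>

lemma uniform_exponent_le:
  fixes n :: nat and \<xi> B :: real
  assumes n: "n \<ge> 3" and \<xi>: "\<not> algebraic \<xi>" and B: "2 * real n - 2 \<le> B"
    and large: "\<And>w. B < w \<Longrightarrow> ((w - n) / (n - 1))\<^sup>2 + (w - n) / (n - 1) > 1"
  shows "uniform_exponent n \<xi> \<le> ereal B"
  unfolding uniform_exponent_def
proof (intro Sup_least, elim imageE CollectE conjE, simp only: ereal_less_eq(3), rule ccontr)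
  fix \<omega> :: real
  assume \<omega>: "\<forall>\<^sub>F H :: real in at_top. \<exists>P \<in> int_polys_upto n.
            naive_height P \<le> H \<and> 0 < \<bar>poly P \<xi>\<bar> \<and> \<bar>poly P \<xi>\<bar> \<le> H powr (- \<omega>)"
    and "\<not> \<omega> \<le> B"
  then have gt: "B < \<omega>" by simp
  have "uniform_approximation n \<xi> \<omega>"
  proof
    show "3 \<le> n" by (rule n)
    show "ev \<xi> p \<noteq> 0" if "p \<noteq> 0" for p
    proof
      assume "ev \<xi> p = 0"
      then have "algebraic \<xi>" using that
        by (intro algebraicI[of "of_int_poly p"]) (auto simp: ev_def)
      then show False using \<xi> by simp
    qed
    show "2 * real n - 2 < \<omega>" using gt B by simp
    show "\<forall>\<^sub>F H in at_top. \<exists>p. p \<noteq> 0 \<and> degree p \<le> n \<and> height p \<le> H \<and> \<bar>ev \<xi> p\<bar> \<le> H powr (- \<omega>)"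
      using \<omega>
    proof eventually_elim
      case (elim H)
      then obtain Q where Q: "Q \<in> int_polys_upto n" "naive_height Q \<le> H" "0 < \<bar>poly Q \<xi>\<bar>" "\<bar>poly Q \<xi>\<bar> \<le> H powr (- \<omega>)"
        by blast
      obtain p where p: "Q = of_int_poly p" "degree p \<le> n" using Q(1) by (rule int_polys_uptoE)
      have "p \<noteq> 0" using Q(3) p by auto
      then show ?case using Q p by (intro exI[of _ p]) (simp add: naive_height_of_int_poly ev_def)
    qed
  qed
  then show False using uniform_approximation.exponent_bound large[OF gt] by blast
qed

theorem theorem1p1:
  fixes n :: nat and \<xi> :: real
  assumes "n \<ge> 3" and "\<not> algebraic \<xi>"
  shows "(n \<ge> 4 \<longrightarrow> uniform_exponent n \<xi> \<le> ereal (2 * real n - 2)) \<and>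
         (n = 3 \<longrightarrow> uniform_exponent 3 \<xi> \<le> ereal (2 + sqrt 5))"
proof (intro conjI impI)
  assume n: "n \<ge> 4"
  have "((w - n) / (n - 1))\<^sup>2 + (w - n) / (n - 1) > 1" if "2 * real n - 2 < w" for w :: real
  proof -
    define t where "t = (w - n) / (real n - 1)"
    \<comment> \<open>Here \<open>t > (n - 2) / (n - 1)\<close>, which is at least 2/3 from
      \<open>n = 4\<close> on, and 4/9 + 2/3 exceeds 1.\<close>
    have "2 / 3 \<le> t" using n that by (simp add: t_def field_simps)
    moreover from this have "(2 / 3)\<^sup>2 \<le> t\<^sup>2" by (intro power_mono) auto
    ultimately have "1 < t\<^sup>2 + t" by (simp add: power2_eq_square)
    then show ?thesis using n by (simp add: t_def of_nat_diff)
  qed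
  then show "uniform_exponent n \<xi> \<le> ereal (2 * real n - 2)"
    using assms by (intro uniform_exponent_le) auto
next
  assume n: "n = 3"
  have s5: "2 \<le> sqrt 5" by (rule real_le_rsqrt) simp
  show "uniform_exponent 3 \<xi> \<le> ereal (2 + sqrt 5)"
  proof (rule uniform_exponent_le)
    fix w :: real assume "2 + sqrt 5 < w"
    \<comment> \<open>For \<open>n = 3\<close> the left-hand side of the condition minus 1 equals
      \<open>((w - 2) ^ 2 - 5) / 4\<close>.\<close>
    then have "(sqrt 5)\<^sup>2 < (w - 2)\<^sup>2" using s5 by (intro power_strict_mono) auto
    then have "((w - 3) / 2)\<^sup>2 + (w - 3) / 2 > 1" by (simp add: power2_eq_square field_simps)
    then show "((w - real 3) / real (3 - 1))\<^sup>2 + (w - real 3) / real (3 - 1) > 1" by simp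
  qed (use assms s5 in auto)
qed

end
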